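(* Let $(k_1,\dots,k_n) \in \mathbb{Z}_{\geq 1}^n$ and $m = k_1 + \dots + k_n$. The triple $(\widetilde{\mathcal{G}}([(k_1,\dots,k_n)]), \widetilde{\phi}, (g_1, \dots, g_m))$ is a $[(k_1,\dots,k_n)]$-expansion group. If $(G, \phi, (h_1, \dots, h_m))$ is any $[(k_1,\dots,k_n)]$-expansion group, then there is a unique epimorphism of $[(k_1,\dots,k_n)]$-expansion groups $\widetilde{\mathcal{G}}([(k_1,\dots,k_n)]) \twoheadrightarrow G$ (sending $g_j \mapsto h_j$). In particular $\#G \leq 2^{m \cdot 2^{n-1} - 2^n + n + 1}$, with equality if and only if this map is an isomorphism.
   Context: $V_{[m]} = \mathbb{F}_2^m$ with basis $e_1,\dots,e_m$. An $m$-expansion group is a triple $(G,\phi,(h_1,\dots,h_m))$: $G$ a group, $\phi: G \to V_{[m]}$ a homomorphism with $\phi(h_j) = e_j$, $h_j^2 = 1$, $\ker \phi$ an elementary abelian $2$-group, and $[G,G] = \ker\phi$. For $i \in [n]$ let $B_i = \{k_1+\dots+k_{i-1}+1,\dots,k_1+\dots+k_i\}$ (the $i$-th block), and let $\pi: V_{[m]} \to \mathbb{F}_2^n$ be the linear map sending $e_j$ to the $i$-th standard basis vector whenever $j \in B_i$. A $[(k_1,\dots,k_n)]$-expansion group is an $m$-expansion group such that $\phi^{-1}(\ker \pi)$ is an elementary abelian $2$-group. A homomorphism of such objects is a group homomorphism sending the $j$-th distinguished generator to the $j$-th distinguished generator. Definition of $\widetilde{\mathcal{G}}$: for $x \in [m]$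 let $b(x)$ be such that $x \in B_{b(x)}$. For $i \in [n]$ let $W_i = \mathbb{F}_2^{[n]\setminus\{i\}}$ with basis $(e_h)_{h \neq i}$, and $\Gamma_i = \mathbb{F}_2[W_i] \rtimes W_i$, $W_i$ acting on the group algebra by multiplication by group elements; $[w]$ is the basis element of $w$, and $\varepsilon: \mathbb{F}_2[W_i] \to \mathbb{F}_2$ the augmentation. For $j \in [m]$ let $g_j \in \prod_{x\in[m]}\Gamma_{b(x)}$ have $x$-component $(0,e_h)$ if $j \in B_h$ with $h \neq b(x)$, and $(\delta_{j,x}[0], 0)$ if $j \in B_{b(x)}$. $\widetilde{\mathcal{G}}([(k_1,\dots,k_n)])$ is the subgroup generated by $g_1,\dots,g_m$, and $\widetilde{\phi}$ sends an element whose $x$-component is $(a_x, w_x)$ to $\sum_{x \in [m]} \varepsilon(a_x) e_x$ (so $\widetilde{\phi}(g_j) = e_j$). *)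

theory Defs
  imports "HOL-Algebra.Algebra"
begin

text \<open>Elements of F_2^S are encoded as subsets of S; addition is symmetric difference.\<close>

definition symd :: "'a set \<Rightarrow> 'a set \<Rightarrow> 'a set" where
  "symd A B = (A - B) \<union> (B - A)"

text \<open>V_[m] = F_2^m, basis vector e_j = {j}, coordinates indexed by {1..m}.\<close>
definition Vgrp :: "nat \<Rightarrow> nat set monoid" where
  "Vgrp m = \<lparr>carrier = Pow {1..m}, monoid.mult = symd,monoid.one = {}\<rparr>"

definition elem_ab2 :: "('g, 'c) monoid_scheme \<Rightarrow> 'g set \<Rightarrow> bool" where
  "elem_ab2 G H \<longleftrightarrow> subgroup H G \<and> (\<forall>x\<in>H. \<forall>y\<in>H. x \<otimes>\<^bsub>G\<^esub> y = y \<otimes>\<^bsub>G\<^esub> x)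
     \<and> (\<forall>x\<in>H. x \<otimes>\<^bsub>G\<^esub> x = \<one>\<^bsub>G\<^esub>)"

definition expansion_group ::
  "nat \<Rightarrow> ('g, 'c) monoid_scheme \<Rightarrow> ('g \<Rightarrow> nat set) \<Rightarrow> (nat \<Rightarrow> 'g) \<Rightarrow> bool" where
  "expansion_group m G \<phi> h \<longleftrightarrow> group G \<and> \<phi> \<in> hom G (Vgrp m)
     \<and> (\<forall>j\<in>{1..m}. h j \<in> carrier G \<and> \<phi> (h j) = {j} \<and> h j \<otimes>\<^bsub>G\<^esub> h j = \<one>\<^bsub>G\<^esub>)
     \<and> elem_ab2 G (kernel G (Vgrp m) \<phi>)
     \<and> derived G (carrier G) = kernel G (Vgrp m) \<phi>"

definition msum :: "(nat \<Rightarrow> nat) \<Rightarrow> nat \<Rightarrow> nat" where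
  "msum k n = (\<Sum>i=1..n. k i)"

definition block :: "(nat \<Rightarrow> nat) \<Rightarrow> nat \<Rightarrow> nat set" where
  "block k i = {(\<Sum>l=1..<i. k l) + 1 .. (\<Sum>l=1..i. k l)}"

definition blk :: "(nat \<Rightarrow> nat) \<Rightarrow> nat \<Rightarrow> nat \<Rightarrow> nat" where
  "blk k n x = (THE i. i \<in> {1..n} \<and> x \<in> block k i)"

definition ker_pi :: "(nat \<Rightarrow> nat) \<Rightarrow> nat \<Rightarrow> nat set set" where
  "ker_pi k n = {A. A \<subseteq> {1..msum k n} \<and> (\<forall>i\<in>{1..n}. even (card (A \<inter> block k i)))}"

definition block_expansion_group ::
  "(nat \<Rightarrow> nat) \<Rightarrow> nat \<Rightarrow> ('g, 'c) monoid_scheme \<Rightarrow> ('g \<Rightarrow> nat set) \<Rightarrow> (nat \<Rightarrow> 'g) \<Rightarrow> bool" where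
  "block_expansion_group k n G \<phi> h \<longleftrightarrow> expansion_group (msum k n) G \<phi> h
     \<and> elem_ab2 G {x \<in> carrier G. \<phi> x \<in> ker_pi k n}"

definition expansion_hom ::
  "nat \<Rightarrow> ('g, 'c) monoid_scheme \<Rightarrow> (nat \<Rightarrow> 'g) \<Rightarrow> ('h, 'd) monoid_scheme \<Rightarrow> (nat \<Rightarrow> 'h)
     \<Rightarrow> ('g \<Rightarrow> 'h) \<Rightarrow> bool" where
  "expansion_hom m G g H h f \<longleftrightarrow> f \<in> hom G H \<and> (\<forall>j\<in>{1..m}. f (g j) = h j)"

text \<open>Gamma_i = F_2[W_i] \<rtimes> W_i, W_i = F_2^([n]-{i}) encoded as subsets of {1..n}-{i};
  an element of the group algebra F_2[W_i] is the set of group elements with coefficient 1.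
  The action of w is multiplication by [w], i.e. translation by w.
  Multiplication: (a,w)(a',w') = (a + w.a', w + w').\<close>
definition translate :: "nat set \<Rightarrow> nat set set \<Rightarrow> nat set set" where
  "translate w a = (\<lambda>u. symd u w) ` a"

definition Gamma :: "nat \<Rightarrow> nat \<Rightarrow> (nat set set \<times> nat set) monoid" where
  "Gamma n i = \<lparr>carrier = Pow (Pow ({1..n} - {i})) \<times> Pow ({1..n} - {i}),
     monoid.mult = (\<lambda>(a, w) (a', w'). (symd a (translate w a'), symd w w')),
    monoid.one = ({}, {})\<rparr>"

text \<open>augmentation epsilon: F_2[W] -> F_2 (true = 1).\<close>
definition augm :: "nat set set \<Rightarrow> bool" where
  "augm a = odd (card a)"

definition Gprod :: "(nat \<Rightarrow> nat) \<Rightarrow> nat \<Rightarrow> (nat \<Rightarrow> nat set set \<times> nat set) monoid" where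
  "Gprod k n = product_group {1..msum k n} (\<lambda>x. Gamma n (blk k n x))"

text \<open>The generators g_j; [0] is the basis element {{}} of the zero vector.\<close>
definition gt :: "(nat \<Rightarrow> nat) \<Rightarrow> nat \<Rightarrow> nat \<Rightarrow> (nat \<Rightarrow> nat set set \<times> nat set)" where
  "gt k n j = (\<lambda>x\<in>{1..msum k n}.
      if j \<in> block k (blk k n x) then ((if j = x then {{}} else {}), {})
      else ({}, {blk k n j}))"

definition Gt :: "(nat \<Rightarrow> nat) \<Rightarrow> nat \<Rightarrow> (nat \<Rightarrow> nat set set \<times> nat set) monoid" where
  "Gt k n = subgroup_generated (Gprod k n) (gt k n ` {1..msum k n})"

definition phit :: "(nat \<Rightarrow> nat) \<Rightarrow> nat \<Rightarrow> (nat \<Rightarrow> nat set set \<times> nat set) \<Rightarrow> nat set" where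
  "phit k n f = {x \<in> {1..msum k n}. augm (fst (f x))}"

end

theory Submission
  imports Defs
begin

text \<open>A word in the generators is a walk from 0 in the Cayley graph of \<open>\<pi>(V) = F\<^sub>2\<^sup>n\<close>, with
  edges coloured by 1..m. In the group \<open>Gt\<close> it is recorded by its end point together with the mod 2
  chain of the edges it traverses, one group algebra \<open>F\<^sub>2[W\<^bsub>b(x)\<^esub>]\<close> for each colour x.
  In a block expansion group G, a choice of elements over the vertices turns every edge into a loop
  in the preimage of \<open>ker \<pi>\<close>. This preimage is an elementary abelian 2-group, so the value of a
  word in G depends only on its chain and its end point; this gives the map from \<open>Gt\<close> to G. It is
  onto since the \<open>h j\<close> generate G, by nilpotency of the augmentation ideal acting on [G,G].
  For \<open>G = Gt\<close> the same products of loops show that every cycle is the chain of a closed walk. Hence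
  the order of \<open>Gt\<close> is \<open>2\<^sup>n\<close> times that of the cycle space of the graph, which has \<open>2\<^sup>n\<close>
  vertices and \<open>m 2\<^bsup>n-1\<^esup>\<close> edges and is connected.\<close>

subsection \<open>Generators, homomorphisms and commutators\<close>

lemma (in group) generate_involutions_induct [consumes 1, case_names subset square one mult]:
  assumes x: "x \<in> generate G S" and S: "S \<subseteq> carrier G"
    and sq: "\<And>s. s \<in> S \<Longrightarrow> s \<otimes> s = \<one>"
    and one: "P \<one>"
    and mult: "\<And>a s. a \<in> generate G S \<Longrightarrow> s \<in> S \<Longrightarrow> P a \<Longrightarrow> P (a \<otimes> s)"
  shows "P x"
proof -
  have "\<forall>a\<in>generate G S. P a \<longrightarrow> P (a \<otimes> x)"
    using x
  proof (induction rule: generate.induct)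
    case one
    show ?case using generate_in_carrier[OF S] by simp
  next
    case (incl s)
    then show ?case using mult by blast
  next
    case (inv s)
    then have "inv s = s"
      using sq S by (metis inv_equality subsetD)
    with inv show ?case using mult by simp
  next
    case (eng x y)
    then show ?case
      using generate_in_carrier[OF S] by (simp add: m_assoc[symmetric] generate.eng)
  qed
  then show ?thesis
    using one generate.one[of G S] generate_in_carrier[OF S x] by force
qed

lemma (in group) inv_mult_cancel_left:
  assumes "a \<in> carrier G" "b \<in> carrier G"
  shows "inv a \<otimes> (a \<otimes> b) = b" "a \<otimes> (inv a \<otimes> b) = b"
  using assms by (simp_all add: m_assoc[symmetric])

lemma hom_eq_on_generate:
  assumes "group G" "group H" "f \<in> hom G H" "f' \<in> hom G H" "S \<subseteq> carrier G"
    and "\<And>s. s \<in> S \<Longrightarrow> f s = f' s" and "x \<in> generate G S"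
  shows "f x = f' x"
proof -
  interpret f: group_hom G H f
    using assms by (simp add: group_hom_def group_hom_axioms_def)
  interpret f': group_hom G H f'
    using assms by (simp add: group_hom_def group_hom_axioms_def)
  show ?thesis
    using assms(7)
  proof (induction rule: generate.induct)
    case (inv s)
    then have "s \<in> carrier G" using assms(5) by blast
    then show ?case using inv assms(6) by simp
  next
    case (eng x y)
    then show ?case using f.G.generate_in_carrier[OF assms(5)] by simp
  qed (simp_all add: assms(6))
qed

lemma (in group_hom) surj_if_generators_in_image:
  assumes "S \<subseteq> h ` carrier G" "generate H S = carrier H"
  shows "h ` carrier G = carrier H"
  using H.generate_subgroup_incl[OF assms(1) img_is_subgroup] assms(2) by auto

lemma (in group_hom) image_subset_if_generators:
  assumes "S \<subseteq> carrier G" "generate G S = carrier G" "h ` S \<subseteq> K" "subgroup K H"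
  shows "h ` carrier G \<subseteq> K"
  using H.generate_subgroup_incl[OF assms(3,4)] generate_img[OF assms(1)] assms(2) by simp

lemma (in group_hom) generate_Un_kernel:
  assumes S: "S \<subseteq> carrier G" and gen: "generate H (h ` S) = carrier H"
  shows "generate G (S \<union> kernel G H h) = carrier G"
proof
  have "S \<union> kernel G H h \<subseteq> carrier G"
    using S by (auto simp: kernel_def)
  then show "generate G (S \<union> kernel G H h) \<subseteq> carrier G"
    by (rule G.generate_incl)
  show "carrier G \<subseteq> generate G (S \<union> kernel G H h)"
  proof
    fix a assume a: "a \<in> carrier G"
    then have "h a \<in> h ` generate G S"
      using hom_closed generate_img[OF S] gen by blast
    then obtain u where u: "u \<in> generate G S" "h u = h a"
      by force
    have uG: "u \<in> carrier G"
      using G.generate_in_carrier[OF S u(1)] .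
    have "inv u \<otimes> a \<in> kernel G H h"
      using a u uG by (simp add: kernel_def)
    then have "inv u \<otimes> a \<in> generate G (S \<union> kernel G H h)"
      by (simp add: generate.incl)
    moreover have "u \<in> generate G (S \<union> kernel G H h)"
      using u(1) G.mono_generate[of S "S \<union> kernel G H h"] by auto
    ultimately have "u \<otimes> (inv u \<otimes> a) \<in> generate G (S \<union> kernel G H h)"
      by (rule generate.eng[rotated])
    then show "a \<in> generate G (S \<union> kernel G H h)"
      using a uG by (simp add: G.inv_mult_cancel_left)
  qed
qed

lemma (in group_hom) order_eq_card_kernel_times_order:
  assumes "h ` carrier G = carrier H"
  shows "order G = card (kernel G H h) * order H"
proof -
  have "order (G Mod kernel G H h) = order H"
    using iso_same_card[OF FactGroup_iso[OF assms]] by (simp add: order_def)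
  then show ?thesis
    using G.lagrange[OF subgroup_kernel] by (simp add: order_def FactGroup_def mult.commute)
qed

lemma (in group) commute_generate:
  assumes "x \<in> carrier G" "S \<subseteq> carrier G" "\<And>s. s \<in> S \<Longrightarrow> x \<otimes> s = s \<otimes> x"
    and "y \<in> generate G S"
  shows "x \<otimes> y = y \<otimes> x"
  using assms(4)
proof (induction rule: generate.induct)
  case (inv s)
  then have s: "s \<in> carrier G"
    using assms(2) by blast
  have "x \<otimes> inv s = inv s \<otimes> (s \<otimes> x) \<otimes> inv s"
    using s assms(1) by (simp add: inv_mult_cancel_left)
  also have "\<dots> = inv s \<otimes> x"
    using s assms(1) by (simp add: assms(3)[OF inv, symmetric] m_assoc)
  finally show ?case .
next
  case (eng y z)
  then have "y \<in> carrier G" "z \<in> carrier G"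
    using generate_in_carrier[OF assms(2)] by auto
  then show ?case
    using eng.IH assms(1) by (metis m_assoc)
qed (use assms in auto)

lemma (in group) comm_group_if_generators_commute:
  assumes S: "S \<subseteq> carrier G" and gen: "generate G S = carrier G"
    and comm: "\<And>s t. s \<in> S \<Longrightarrow> t \<in> S \<Longrightarrow> s \<otimes> t = t \<otimes> s"
  shows "comm_group G"
proof (rule group_comm_groupI)
  have commute_S: "x \<otimes> s = s \<otimes> x" if "x \<in> carrier G" "s \<in> S" for x s
    using commute_generate[of s S x] that S gen comm by auto
  show "x \<otimes> y = y \<otimes> x" if "x \<in> carrier G" "y \<in> carrier G" for x y
    using commute_generate[of x S y] that S gen commute_S by auto
qed

lemma (in group) normal_if_normalized_by_generators:
  assumes Y: "subgroup Y G" and S: "S \<subseteq> carrier G" and gen: "generate G S = carrier G"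
    and conj: "\<And>s y. s \<in> S \<Longrightarrow> y \<in> Y \<Longrightarrow> s \<otimes> y \<otimes> inv s \<in> Y"
      "\<And>s y. s \<in> S \<Longrightarrow> y \<in> Y \<Longrightarrow> inv s \<otimes> y \<otimes> s \<in> Y"
  shows "Y \<lhd> G"
proof (rule normal_invI[OF Y])
  have "\<forall>y\<in>Y. a \<otimes> y \<otimes> inv a \<in> Y" if "a \<in> generate G S" for a
    using that
  proof (induction rule: generate.induct)
    case one
    show ?case using subgroup.mem_carrier[OF Y] by simp
  next
    case (incl s)
    then show ?case using conj by blast
  next
    case (inv s)
    then have "s \<in> carrier G" using S by blast
    with inv show ?case using conj(2) by simp
  next
    case (eng a c)
    have "a \<otimes> c \<otimes> y \<otimes> inv (a \<otimes> c) = a \<otimes> (c \<otimes> y \<otimes> inv c) \<otimes> inv a" if "y \<in> Y" for y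
      using eng generate_in_carrier[OF S] subgroup.mem_carrier[OF Y that]
      by (simp add: m_assoc inv_mult_group)
    then show ?case using eng by simp
  qed
  then show "a \<otimes> y \<otimes> inv a \<in> Y" if "a \<in> carrier G" "y \<in> Y" for a y
    using that gen by blast
qed

definition commutator :: "('a, 'b) monoid_scheme \<Rightarrow> 'a \<Rightarrow> 'a \<Rightarrow> 'a" where
  "commutator G a b = a \<otimes>\<^bsub>G\<^esub> b \<otimes>\<^bsub>G\<^esub> inv\<^bsub>G\<^esub> a \<otimes>\<^bsub>G\<^esub> inv\<^bsub>G\<^esub> b"

lemma (in group) commutator_closed [simp]:
  "a \<in> carrier G \<Longrightarrow> b \<in> carrier G \<Longrightarrow> commutator G a b \<in> carrier G"
  by (simp add: commutator_def)

lemma (in group) commutator_swap: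
  "a \<in> carrier G \<Longrightarrow> b \<in> carrier G \<Longrightarrow> commutator G b a = inv (commutator G a b)"
  by (simp add: commutator_def inv_mult_group m_assoc)

lemma (in group) commutator_mult_eq:
  "a \<in> carrier G \<Longrightarrow> b \<in> carrier G \<Longrightarrow> commutator G a b \<otimes> (b \<otimes> a) = a \<otimes> b"
  by (simp add: commutator_def m_assoc) (simp add: m_assoc[symmetric])

lemma (in group) commutator_in_derived:
  "a \<in> carrier G \<Longrightarrow> b \<in> carrier G \<Longrightarrow> commutator G a b \<in> derived G (carrier G)"
  unfolding derived_def commutator_def by (blast intro: generate.incl)

lemma (in group) derived_subset_if_generators_commute_mod:
  assumes Y: "Y \<lhd> G" and S: "S \<subseteq> carrier G" and gen: "generate G S = carrier G"
    and comm: "\<And>s t. s \<in> S \<Longrightarrow> t \<in> S \<Longrightarrow> commutator G s t \<in> Y"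
  shows "derived G (carrier G) \<subseteq> Y"
proof (rule derived_minimal[OF Y])
  interpret Y: normal Y G by (rule Y)
  interpret q: group_hom G "G Mod Y" "(#>) Y"
    using Y.r_coset_hom_Mod Y.factorgroup_is_group
    by (simp add: group_hom_def group_hom_axioms_def)
  show "comm_group (G Mod Y)"
  proof (rule q.H.comm_group_if_generators_commute)
    show "(#>) Y ` S \<subseteq> carrier (G Mod Y)"
      using S by auto
    show "generate (G Mod Y) ((#>) Y ` S) = carrier (G Mod Y)"
      using q.generate_img[OF S] gen by (auto simp: FactGroup_def RCOSETS_def)
    fix u v assume "u \<in> (#>) Y ` S" "v \<in> (#>) Y ` S"
    then obtain s t where st: "s \<in> S" "u = Y #> s" "t \<in> S" "v = Y #> t"
      by blast
    then have car: "s \<in> carrier G" "t \<in> carrier G"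
      using S by auto
    have "Y #> (s \<otimes> t) = (Y #> commutator G s t) \<otimes>\<^bsub>G Mod Y\<^esub> (Y #> (t \<otimes> s))"
      using car q.hom_mult[of "commutator G s t" "t \<otimes> s"] by (simp add: commutator_mult_eq)
    also have "Y #> commutator G s t = \<one>\<^bsub>G Mod Y\<^esub>"
      using comm st by (simp add: Y.rcos_const)
    also have "\<one>\<^bsub>G Mod Y\<^esub> \<otimes>\<^bsub>G Mod Y\<^esub> (Y #> (t \<otimes> s)) = Y #> (t \<otimes> s)"
      using car by (intro q.H.l_one q.hom_closed) simp
    finally show "u \<otimes>\<^bsub>G Mod Y\<^esub> v = v \<otimes>\<^bsub>G Mod Y\<^esub> u"
      using st car q.hom_mult by metis
  qed
qed

lemma (in group) square_zero_image_redundant: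
  assumes d: "d \<in> hom G G" "\<And>x. x \<in> carrier G \<Longrightarrow> d (d x) = \<one>"
    and Z: "Z \<subseteq> carrier G" "d ` Z \<subseteq> Z"
    and gen: "generate G (Z \<union> d ` carrier G) = carrier G"
  shows "generate G Z = carrier G"
proof -
  interpret d: group_hom G G d
    using d(1) is_group by (simp add: group_hom_def group_hom_axioms_def)
  have "d ` (Z \<union> d ` carrier G) \<subseteq> Z \<union> {\<one>}"
    using d(2) Z(2) by auto
  also have "\<dots> \<subseteq> generate G Z"
    by (auto intro: generate.one generate.incl)
  finally have "d ` carrier G \<subseteq> generate G Z"
    using Z(1) gen generate_is_subgroup[OF Z(1)]
    by (intro d.image_subset_if_generators[of "Z \<union> d ` carrier G"]) auto
  then have "Z \<union> d ` carrier G \<subseteq> generate G Z"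
    by (auto intro: generate.incl)
  then show ?thesis
    using generate_subgroup_incl[OF _ generate_is_subgroup[OF Z(1)]] generate_incl[OF Z(1)] gen
    by blast
qed

text \<open>For an elementary abelian 2-group acting in characteristic 2, the operators \<open>d = s - 1\<close>
  commute and square to zero.\<close>

lemma (in comm_group) nakayama_nilpotent:
  assumes "finite D" "D \<subseteq> hom G G" "subgroup M G"
    and "\<And>d. d \<in> D \<Longrightarrow> d ` M \<subseteq> M"
    and "\<And>d x. d \<in> D \<Longrightarrow> x \<in> carrier G \<Longrightarrow> d (d x) = \<one>"
    and "\<And>d e x. d \<in> D \<Longrightarrow> e \<in> D \<Longrightarrow> x \<in> carrier G \<Longrightarrow> d (e x) = e (d x)"
    and "generate G (M \<union> (\<Union>d\<in>D. d ` carrier G)) = carrier G"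
  shows "M = carrier G"
  using assms
proof (induction D rule: finite_induct)
  case empty
  then show ?case
    using generate_subgroup_incl[of M M] subgroup.subset[of M G] by simp
next
  case (insert d D)
  let ?Z = "M \<union> (\<Union>e\<in>D. e ` carrier G)"
  have closed: "e x \<in> carrier G" if "e \<in> insert d D" "x \<in> carrier G" for e x
    using insert.prems(1) that by (auto simp: hom_def)
  have "d ` e ` carrier G \<subseteq> e ` carrier G" if "e \<in> D" for e
    using insert.prems(5)[of d e] closed that by auto
  then have "(\<Union>e\<in>D. d ` e ` carrier G) \<subseteq> (\<Union>e\<in>D. e ` carrier G)"
    by (rule UN_mono[OF order_refl])
  moreover have "d ` M \<subseteq> M"
    using insert.prems(3) by simp
  ultimately have stable: "d ` ?Z \<subseteq> ?Z"
    unfolding image_Un image_UN by (intro Un_mono)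
  have "generate G ?Z = carrier G"
  proof (rule square_zero_image_redundant[OF _ _ _ stable])
    show "?Z \<subseteq> carrier G"
      using subgroup.subset[OF insert.prems(2)] closed by auto
    show "generate G (?Z \<union> d ` carrier G) = carrier G"
      using insert.prems(6) by (simp add: ac_simps)
  qed (use insert.prems(1,4) in auto)
  then show ?case
    using insert by (intro insert.IH) auto
qed

locale abelian_normal_subgroup = normal N G for N and G (structure) +
  assumes abelian: "x \<in> N \<Longrightarrow> y \<in> N \<Longrightarrow> x \<otimes> y = y \<otimes> x"
begin

abbreviation A :: "('a, 'b) monoid_scheme" where
  "A \<equiv> G\<lparr>carrier := N\<rparr>"

sublocale A: comm_group A
  using subgroup_imp_group[OF subgroup_axioms] abelian
  by (intro group.group_comm_groupI) auto

lemma left_commute: "x \<in> N \<Longrightarrow> y \<in> N \<Longrightarrow> z \<in> N \<Longrightarrow> x \<otimes> (y \<otimes> z) = y \<otimes> (x \<otimes> z)"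
  using A.m_lcomm by simp

lemma commutator_in: "a \<in> carrier G \<Longrightarrow> y \<in> N \<Longrightarrow> commutator G a y \<in> N"
  by (simp add: commutator_def inv_op_closed2)

lemma commutator_eq_one: "x \<in> N \<Longrightarrow> y \<in> N \<Longrightarrow> commutator G x y = \<one>"
  using abelian[of x y] by (simp add: commutator_def m_assoc)

lemma conj_mult:
  "a \<in> carrier G \<Longrightarrow> y \<in> N \<Longrightarrow> z \<in> N \<Longrightarrow>
    a \<otimes> (y \<otimes> z) \<otimes> inv a = (a \<otimes> y \<otimes> inv a) \<otimes> (a \<otimes> z \<otimes> inv a)"
  by (simp add: m_assoc) (simp add: m_assoc[symmetric])

lemma commutator_mult:
  assumes "a \<in> carrier G" "y \<in> N" "z \<in> N"
  shows "commutator G a (y \<otimes> z) = commutator G a y \<otimes> commutator G a z"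
proof -
  have swap: "p \<otimes> q \<otimes> (inv z \<otimes> inv y) = p \<otimes> inv y \<otimes> (q \<otimes> inv z)" if "p \<in> N" "q \<in> N" for p q
    using that assms abelian[of "inv z" "inv y"] by (simp add: m_assoc left_commute)
  have "commutator G a (y \<otimes> z) = (a \<otimes> y \<otimes> inv a) \<otimes> (a \<otimes> z \<otimes> inv a) \<otimes> (inv z \<otimes> inv y)"
    using assms by (simp add: commutator_def conj_mult inv_mult_group)
  also have "\<dots> = commutator G a y \<otimes> commutator G a z"
    unfolding commutator_def using assms by (intro swap inv_op_closed2)
  finally show ?thesis .
qed

lemma commutator_hom: "a \<in> carrier G \<Longrightarrow> commutator G a \<in> hom A A"
  by (auto intro!: homI simp: commutator_in commutator_mult)

lemma commutator_commute:
  assumes a: "a \<in> carrier G" and b: "b \<in> carrier G" and ab: "commutator G a b \<in> N" and y: "y \<in> N"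
  shows "commutator G a (commutator G b y) = commutator G b (commutator G a y)"
proof -
  have expand: "commutator G a (commutator G b y) =
      (a \<otimes> b) \<otimes> y \<otimes> inv (a \<otimes> b) \<otimes> (inv (a \<otimes> y \<otimes> inv a) \<otimes> (y \<otimes> inv (b \<otimes> y \<otimes> inv b)))"
    if "a \<in> carrier G" "b \<in> carrier G" for a b
    using that y by (simp add: commutator_def m_assoc inv_mult_group inv_mult_cancel_left)
  let ?z = "(b \<otimes> a) \<otimes> y \<otimes> inv (b \<otimes> a)"
  have z: "?z \<in> N"
    using a b y by (simp add: inv_op_closed2)
  have "(a \<otimes> b) \<otimes> y \<otimes> inv (a \<otimes> b) = commutator G a b \<otimes> ?z \<otimes> inv (commutator G a b)"
    unfolding commutator_mult_eq[OF a b, symmetric] using a b y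
    by (simp add: m_assoc inv_mult_group)
  also have "\<dots> = ?z"
    using abelian[OF ab z] ab z by (simp add: m_assoc)
  finally have conj_swap: "(a \<otimes> b) \<otimes> y \<otimes> inv (a \<otimes> b) = ?z" .
  have "inv (a \<otimes> y \<otimes> inv a) \<in> N" "inv (b \<otimes> y \<otimes> inv b) \<in> N"
    using a b y inv_op_closed2 by blast+
  then have "inv (a \<otimes> y \<otimes> inv a) \<otimes> (y \<otimes> inv (b \<otimes> y \<otimes> inv b))
      = inv (b \<otimes> y \<otimes> inv b) \<otimes> (y \<otimes> inv (a \<otimes> y \<otimes> inv a))"
    using y A.m_ac by simp
  then show ?thesis
    unfolding expand[OF a b] expand[OF b a] conj_swap by simp
qed

lemma commutator_commutator_eq_one:
  assumes a: "a \<in> carrier G" "a \<otimes> a \<in> N" and sq: "\<And>y. y \<in> N \<Longrightarrow> y \<otimes> y = \<one>" and y: "y \<in> N"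
  shows "commutator G a (commutator G a y) = \<one>"
proof -
  let ?c = "\<lambda>y. a \<otimes> y \<otimes> inv a"
  have inv_self: "inv z = z" if "z \<in> N" for z
    using sq[OF that] that by (metis inv_equality mem_carrier)
  have "?c (?c y) = (a \<otimes> a) \<otimes> y \<otimes> inv (a \<otimes> a)"
    using a y by (simp add: m_assoc inv_mult_group)
  then have conj_conj: "?c (?c y) = y"
    using abelian[OF a(2) y] a y by (simp add: m_assoc)
  have conj_in: "?c y \<in> N"
    using a y inv_op_closed2 by blast
  have "commutator G a (commutator G a y) = ?c (?c y \<otimes> y) \<otimes> (?c y \<otimes> y)"
    using conj_in y inv_self[of "?c y \<otimes> y"] inv_self[of y] by (simp add: commutator_def)
  also have "\<dots> = (y \<otimes> ?c y) \<otimes> (?c y \<otimes> y)"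
    using conj_mult[OF a(1) conj_in y] conj_conj by simp
  also have "\<dots> = (?c y \<otimes> y) \<otimes> (?c y \<otimes> y)"
    using abelian[OF conj_in y] by simp
  finally show ?thesis
    using sq conj_in y by simp
qed

lemma conj_inv_eq_conj:
  assumes a: "a \<in> carrier G" "a \<otimes> a \<in> N" and y: "y \<in> N"
  shows "inv a \<otimes> y \<otimes> a = a \<otimes> y \<otimes> inv a"
proof -
  have "inv a \<otimes> y \<otimes> a \<in> N"
    using inv_op_closed2[of "inv a" y] a y by simp
  then have "inv a \<otimes> y \<otimes> a = (a \<otimes> a) \<otimes> (inv a \<otimes> y \<otimes> a) \<otimes> inv (a \<otimes> a)"
    using abelian[OF a(2)] a by (simp add: m_assoc)
  also have "\<dots> = a \<otimes> y \<otimes> inv a"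
    using a y by (simp add: m_assoc inv_mult_group) (simp add: m_assoc[symmetric])
  finally show ?thesis .
qed

lemma normal_if_commutators_in:
  fixes S Y :: "'a set"
  assumes S: "S \<subseteq> carrier G" "\<And>s. s \<in> S \<Longrightarrow> s \<otimes> s \<in> N"
    and gen: "generate G (S \<union> N) = carrier G"
    and Y: "subgroup Y G" "Y \<subseteq> N"
    and comm: "\<And>s y. s \<in> S \<Longrightarrow> y \<in> N \<Longrightarrow> commutator G s y \<in> Y"
  shows "Y \<lhd> G"
proof (rule normal_if_normalized_by_generators[OF Y(1) _ gen])
  show "S \<union> N \<subseteq> carrier G"
    using S subset by simp
  have conjS: "s \<otimes> y \<otimes> inv s \<in> Y" if "s \<in> S" "y \<in> Y" for s y
  proof -
    have "commutator G s y \<otimes> y \<in> Y"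
      using that comm Y(2) by (intro subgroup.m_closed[OF Y(1)]) auto
    moreover have "s \<in> carrier G" "y \<in> carrier G"
      using that S Y subset by auto
    ultimately show ?thesis
      by (simp add: commutator_def m_assoc)
  qed
  have conjN: "x \<otimes> y \<otimes> inv x = y" "inv x \<otimes> y \<otimes> x = y" if "x \<in> N" "y \<in> Y" for x y
    using that Y(2) abelian[of x y] abelian[of "inv x" y] by (auto simp: m_assoc subset_iff)
  show "s \<otimes> y \<otimes> inv s \<in> Y" if "s \<in> S \<union> N" "y \<in> Y" for s y
    using that conjS conjN by auto
  show "inv s \<otimes> y \<otimes> s \<in> Y" if "s \<in> S \<union> N" "y \<in> Y" for s y
  proof (cases "s \<in> N")
    case True
    then show ?thesis using that conjN by simp
  next
    case False
    then have "s \<in> S" "y \<in> N" using that Y(2) by auto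
    then have "inv s \<otimes> y \<otimes> s = s \<otimes> y \<otimes> inv s"
      using S by (intro conj_inv_eq_conj) auto
    then show ?thesis using conjS \<open>s \<in> S\<close> that by simp
  qed
qed

lemma derived_subset_if_commutators_in:
  fixes S Y :: "'a set"
  assumes S: "S \<subseteq> carrier G" "\<And>s. s \<in> S \<Longrightarrow> s \<otimes> s \<in> N"
    and gen: "generate G (S \<union> N) = carrier G"
    and Y: "subgroup Y G" "Y \<subseteq> N"
    and SS: "\<And>s t. s \<in> S \<Longrightarrow> t \<in> S \<Longrightarrow> commutator G s t \<in> Y"
    and SN: "\<And>s y. s \<in> S \<Longrightarrow> y \<in> N \<Longrightarrow> commutator G s y \<in> Y"
  shows "derived G (carrier G) \<subseteq> Y"
proof (rule derived_subset_if_generators_commute_mod[OF _ _ gen])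
  show "Y \<lhd> G"
    by (rule normal_if_commutators_in[OF S gen Y SN])
  show "S \<union> N \<subseteq> carrier G"
    using S subset by simp
  have NS: "commutator G x s \<in> Y" if "x \<in> N" "s \<in> S" for x s
    using commutator_swap[of s x] SN[OF that(2,1)] that S subset subgroup.m_inv_closed[OF Y(1)]
    by auto
  have NN: "commutator G x y \<in> Y" if "x \<in> N" "y \<in> N" for x y
    using commutator_eq_one[OF that] subgroup.one_closed[OF Y(1)] by simp
  show "commutator G s t \<in> Y" if "s \<in> S \<union> N" "t \<in> S \<union> N" for s t
    using that SS SN NS NN by blast
qed

lemma commutator_nakayama:
  fixes S M :: "'a set"
  assumes N: "\<And>y. y \<in> N \<Longrightarrow> y \<otimes> y = \<one>"
    and S: "finite S" "S \<subseteq> carrier G" "\<And>s. s \<in> S \<Longrightarrow> s \<otimes> s \<in> N"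
      "\<And>s t. s \<in> S \<Longrightarrow> t \<in> S \<Longrightarrow> commutator G s t \<in> N"
    and M: "subgroup M G" "M \<subseteq> N" "\<And>s y. s \<in> S \<Longrightarrow> y \<in> M \<Longrightarrow> commutator G s y \<in> M"
    and span: "N \<subseteq> generate G (M \<union> (\<Union>s\<in>S. commutator G s ` N))"
  shows "M = N"
proof -
  have sub: "M \<union> (\<Union>s\<in>S. commutator G s ` N) \<subseteq> N"
    using M(2) S(2) commutator_in by auto
  have "M = carrier A"
  proof (rule A.nakayama_nilpotent)
    show "subgroup M A"
      using M(2) by (intro subgroup_incl[OF M(1) subgroup_axioms])
    show "d ` M \<subseteq> M" if "d \<in> commutator G ` S" for d
      using that M(3) by auto
    show "generate A (M \<union> (\<Union>d\<in>commutator G ` S. d ` carrier A)) = carrier A"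
      using span generate_consistent[OF sub subgroup_axioms]
        generate_subgroup_incl[OF sub subgroup_axioms] by simp
    show "d (d x) = \<one>\<^bsub>A\<^esub>" if "d \<in> commutator G ` S" "x \<in> carrier A" for d x
      using that S N commutator_commutator_eq_one by auto
    show "d (e x) = e (d x)"
      if "d \<in> commutator G ` S" "e \<in> commutator G ` S" "x \<in> carrier A" for d e x
      using that S(4) by (auto intro!: commutator_commute subsetD[OF S(2)])
  qed (use S commutator_hom in auto)
  then show ?thesis
    by simp
qed

end

text \<open>Written additively, \<open>N = [G,G]\<close> is the sum of \<open>M = \<langle>S\<rangle> \<inter> N\<close> and of all \<open>(s - 1) N\<close> for s in S,
  so that \<open>M = N\<close> by Nakayama.\<close>

theorem (in group) generate_eq_carrier_if_generate_Un_derived: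
  assumes elem: "elem_ab2 G (derived G (carrier G))"
    and S: "finite S" "S \<subseteq> carrier G" "\<And>s. s \<in> S \<Longrightarrow> s \<otimes> s \<in> derived G (carrier G)"
    and gen: "generate G (S \<union> derived G (carrier G)) = carrier G"
  shows "generate G S = carrier G"
proof -
  define N where "N = derived G (carrier G)"
  interpret abelian_normal_subgroup N G
    using elem derived_self_is_normal
    by (simp add: N_def elem_ab2_def abelian_normal_subgroup_def abelian_normal_subgroup_axioms_def)
  define M where "M = generate G S \<inter> N"
  let ?Z = "M \<union> (\<Union>s\<in>S. commutator G s ` N)"
  have M: "subgroup M G"
    unfolding M_def using generate_is_subgroup[OF S(2)] subgroup_axioms
    by (rule subgroups_Inter_pair)
  have S_comm: "commutator G s x \<in> generate G S" if "s \<in> S" "x \<in> generate G S" for s x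
    using that generate_m_inv_closed[OF S(2)] unfolding commutator_def
    by (intro generate.eng) (auto intro: generate.incl)
  have SS: "commutator G s t \<in> M" if "s \<in> S" "t \<in> S" for s t
    using that S_comm S(2) commutator_in_derived[of s t]
    by (auto simp: M_def N_def intro: generate.incl)
  have Z: "?Z \<subseteq> N"
    using commutator_in S(2) by (auto simp: M_def)
  have "derived G (carrier G) \<subseteq> generate G ?Z"
  proof (rule derived_subset_if_commutators_in[OF S(2)])
    show "subgroup (generate G ?Z) G"
      by (rule generate_is_subgroup[OF order.trans[OF Z subset]])
    show "generate G ?Z \<subseteq> N"
      by (rule generate_subgroup_incl[OF Z subgroup_axioms])
  qed (use S(3) gen SS in \<open>auto simp: N_def intro: generate.incl\<close>)
  moreover have "y \<otimes> y = \<one>" if "y \<in> N" for y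
    using elem that by (simp add: elem_ab2_def N_def)
  ultimately have "M = N"
    using S M SS S_comm commutator_in by (intro commutator_nakayama) (auto simp: M_def N_def)
  then have "S \<union> N \<subseteq> generate G S"
    by (auto simp: M_def intro: generate.incl)
  then show ?thesis
    using generate_subgroup_incl[OF _ generate_is_subgroup[OF S(2)]] gen generate_incl[OF S(2)]
    by (metis N_def subset_antisym)
qed

subsection \<open>Vector spaces over the field with two elements\<close>

lemma in_symd [simp]: "x \<in> symd A B \<longleftrightarrow> (x \<in> A) \<noteq> (x \<in> B)"
  by (auto simp: symd_def)

lemma symd_commute: "symd A B = symd B A"
  by auto

lemma symd_assoc: "symd (symd A B) C = symd A (symd B C)"
  by auto

lemma symd_empty [simp]: "symd A {} = A" "symd {} A = A"
  by auto

lemma symd_self [simp]: "symd A A = {}"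
  by auto

lemma symd_cancel [simp]: "symd A (symd A B) = B" "symd (symd B A) A = B"
  by auto

lemma symd_subset: "A \<subseteq> C \<Longrightarrow> B \<subseteq> C \<Longrightarrow> symd A B \<subseteq> C"
  by (auto simp: symd_def)

lemma symd_singletons: "x \<noteq> y \<Longrightarrow> symd ({x} - C) ({y} - C) = {x, y} - C"
  by auto

lemma odd_card_symd:
  assumes "finite A" "finite B"
  shows "odd (card (symd A B)) \<longleftrightarrow> odd (card A) \<noteq> odd (card B)"
proof -
  have "card (symd A B) = card (A - B) + card (B - A)"
    unfolding symd_def using assms by (intro card_Un_disjoint) auto
  moreover have "card A = card (A \<inter> B) + card (A - B)" "card B = card (B \<inter> A) + card (B - A)"
    using assms by (simp_all add: card_Int_Diff)
  ultimately show ?thesis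
    by (simp add: Int_commute) blast
qed

definition F2_space :: "'a set \<Rightarrow> 'a set monoid" where
  "F2_space S = \<lparr>carrier = Pow S, monoid.mult = symd, monoid.one = {}\<rparr>"

lemma F2_space_simps [simp]:
  "carrier (F2_space S) = Pow S" "x \<otimes>\<^bsub>F2_space S\<^esub> y = symd x y" "\<one>\<^bsub>F2_space S\<^esub> = {}"
  by (simp_all add: F2_space_def)

lemma Vgrp_eq_F2_space: "Vgrp m = F2_space {1..m}"
  by (simp add: Vgrp_def F2_space_def)

lemma order_F2_space: "finite S \<Longrightarrow> order (F2_space S) = 2 ^ card S"
  by (simp add: order_def card_Pow)

lemma comm_group_F2_space: "comm_group (F2_space S)"
proof (rule comm_groupI)
  fix x assume "x \<in> carrier (F2_space S)"
  then show "\<exists>y\<in>carrier (F2_space S). y \<otimes>\<^bsub>F2_space S\<^esub> x = \<one>\<^bsub>F2_space S\<^esub>"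
    by (intro bexI[of _ x]) auto
qed (auto simp: symd_assoc symd_subset symd_commute)

lemma group_F2_space: "group (F2_space S)"
  using comm_group_F2_space by (rule comm_group.axioms)

lemma inv_F2_space: "A \<subseteq> S \<Longrightarrow> inv\<^bsub>F2_space S\<^esub> A = A"
  by (intro group.inv_equality[OF group_F2_space]) auto

lemma generate_F2_space:
  assumes "finite S"
  shows "generate (F2_space S) ((\<lambda>x. {x}) ` S) = Pow S"
proof
  show "generate (F2_space S) ((\<lambda>x. {x}) ` S) \<subseteq> Pow S"
    using group.generate_incl[OF group_F2_space, of "(\<lambda>x. {x}) ` S" S] by auto
  have "A \<in> generate (F2_space S) ((\<lambda>x. {x}) ` S)" if "finite A" "A \<subseteq> S" for A
    using that
  proof (induction A rule: finite_induct)
    case empty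
    show ?case using generate.one[of "F2_space S"] by simp
  next
    case (insert x A)
    have "insert x A = {x} \<otimes>\<^bsub>F2_space S\<^esub> A"
      using insert.hyps by auto
    moreover have "{x} \<in> generate (F2_space S) ((\<lambda>x. {x}) ` S)"
      using insert.prems by (intro generate.incl) auto
    ultimately show ?case
      using insert by (metis generate.eng insert_subset)
  qed
  then show "Pow S \<subseteq> generate (F2_space S) ((\<lambda>x. {x}) ` S)"
    using assms finite_subset by blast
qed

lemma (in comm_monoid) finprod_of_singleton: "f x \<in> carrier G \<Longrightarrow> finprod G f {x} = f x"
  by (subst finprod_insert) auto

lemma (in comm_group) finprod_hom_F2_space:
  assumes S: "finite S" and f: "f \<in> S \<rightarrow> carrier G" and sq: "\<And>x. x \<in> S \<Longrightarrow> f x \<otimes> f x = \<one>"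
  shows "finprod G f \<in> hom (F2_space S) G"
proof (rule homI)
  fix A B assume AB: "A \<in> carrier (F2_space S)" "B \<in> carrier (F2_space S)"
  have fin: "finite A" "finite B"
    using AB S finite_subset by auto
  let ?P = "finprod G f"
  have split: "?P (C - D) \<otimes> ?P (C \<inter> D) = ?P C" if "C \<subseteq> S" for C D
    using that f S finite_subset[OF that S]
    by (subst finprod_Un_disjoint[symmetric]) (auto simp: Un_Diff_Int)
  have "?P (A \<inter> B) \<otimes> ?P (A \<inter> B) = finprod G (\<lambda>x. f x \<otimes> f x) (A \<inter> B)"
    using AB f by (intro finprod_multf[symmetric]) auto
  also have "\<dots> = \<one>"
    using AB sq by (intro finprod_one_eqI) auto
  finally have Int: "?P (A \<inter> B) \<otimes> ?P (A \<inter> B) = \<one>" .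
  have car: "?P (A - B) \<in> carrier G" "?P (B - A) \<in> carrier G" "?P (A \<inter> B) \<in> carrier G"
    using AB f by (auto intro!: finprod_closed)
  have "?P A \<otimes> ?P B = (?P (A - B) \<otimes> ?P (A \<inter> B)) \<otimes> (?P (B - A) \<otimes> ?P (A \<inter> B))"
    using AB split[of A B] split[of B A] by (simp add: Int_commute)
  also have "\<dots> = ?P (A - B) \<otimes> ?P (B - A) \<otimes> (?P (A \<inter> B) \<otimes> ?P (A \<inter> B))"
    using car by (simp add: m_ac)
  also have "\<dots> = ?P (A - B) \<otimes> ?P (B - A)"
    using car Int by simp
  also have "\<dots> = ?P (symd A B)"
    unfolding symd_def using fin AB f by (subst finprod_Un_disjoint) auto
  finally show "?P (A \<otimes>\<^bsub>F2_space S\<^esub> B) = ?P A \<otimes> ?P B"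
    by simp
qed (use f in \<open>auto intro!: finprod_closed\<close>)

lemma hom_F2_space_eqI:
  assumes "finite S" "group G" "f \<in> hom (F2_space S) G" "f' \<in> hom (F2_space S) G"
    and "\<And>x. x \<in> S \<Longrightarrow> f {x} = f' {x}" and "A \<subseteq> S"
  shows "f A = f' A"
  by (rule hom_eq_on_generate[OF group_F2_space assms(2-4), of "(\<lambda>x. {x}) ` S"])
    (use assms generate_F2_space[OF assms(1)] in auto)

subsection \<open>Generators of expansion groups\<close>

lemma elem_ab2_subset:
  "elem_ab2 G H \<Longrightarrow> subgroup K G \<Longrightarrow> K \<subseteq> H \<Longrightarrow> elem_ab2 G K"
  unfolding elem_ab2_def by blast

lemma (in group_hom) derived_subset_kernel:
  assumes "comm_group H"
  shows "derived G (carrier G) \<subseteq> kernel G H h"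
proof -
  have "h ` derived G (carrier G) = derived H (h ` carrier G)"
    by (rule derived_img[symmetric]) simp
  also have "\<dots> = {\<one>\<^bsub>H\<^esub>}"
    by (rule comm_group.derived_eq_singleton[OF assms]) auto
  finally show ?thesis
    using G.derived_in_carrier[of "carrier G"] by (auto simp: kernel_def)
qed

lemma expansion_group_generated:
  fixes G (structure)
  assumes "expansion_group m G \<phi> h"
  shows "generate G (h ` {1..m}) = carrier G"
proof -
  have G: "group G" and hom: "\<phi> \<in> hom G (Vgrp m)"
    and elem: "elem_ab2 G (kernel G (Vgrp m) \<phi>)"
    and der: "derived G (carrier G) = kernel G (Vgrp m) \<phi>"
    and h: "\<And>j. j \<in> {1..m} \<Longrightarrow> h j \<in> carrier G \<and> \<phi> (h j) = {j} \<and> h j \<otimes> h j = \<one>"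
    using assms by (auto simp: expansion_group_def)
  interpret group_hom G "Vgrp m" \<phi>
    using G hom by (simp add: group_hom_def group_hom_axioms_def Vgrp_eq_F2_space group_F2_space)
  have "\<phi> ` h ` {1..m} = (\<lambda>j. {j}) ` {1..m}"
    using h by (auto simp: image_image)
  then have "generate G (h ` {1..m} \<union> kernel G (Vgrp m) \<phi>) = carrier G"
    using h generate_F2_space[of "{1..m}"]
    by (intro generate_Un_kernel) (auto simp: Vgrp_eq_F2_space)
  then show ?thesis
    unfolding der[symmetric]
  proof (rule G.generate_eq_carrier_if_generate_Un_derived[rotated -1])
    show "elem_ab2 G (derived G (carrier G))"
      using elem by (simp add: der)
    show "s \<otimes> s \<in> derived G (carrier G)" if "s \<in> h ` {1..m}" for s
      using that h subgroup.one_closed[OF subgroup_kernel] by (auto simp: der)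
  qed (use h in auto)
qed

text \<open>By the universal property of \<open>V\<close>, the projection of G to \<open>G/[G,G]\<close> factors through \<open>\<phi>\<close>.\<close>

lemma kernel_subset_derived:
  fixes G (structure)
  assumes G: "group G" and hom: "\<phi> \<in> hom G (Vgrp m)"
    and h: "\<And>j. j \<in> {1..m} \<Longrightarrow> h j \<in> carrier G \<and> \<phi> (h j) = {j} \<and> h j \<otimes> h j = \<one>"
    and gen: "generate G (h ` {1..m}) = carrier G"
  shows "kernel G (Vgrp m) \<phi> \<subseteq> derived G (carrier G)"
proof
  interpret group G by (rule G)
  define D where "D = derived G (carrier G)"
  interpret D: normal D G
    unfolding D_def by (rule derived_self_is_normal)
  interpret Q: comm_group "G Mod D"
    unfolding D_def by (rule derived_quot_is_comm_group)
  interpret q: group_hom G "G Mod D" "(#>) D"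
    using D.r_coset_hom_Mod by (simp add: group_hom_def group_hom_axioms_def)
  define f where "f = finprod (G Mod D) (\<lambda>j. D #> h j)"
  have f_hom: "f \<in> hom (Vgrp m) (G Mod D)"
    unfolding f_def Vgrp_eq_F2_space
  proof (rule Q.finprod_hom_F2_space)
    show "(\<lambda>j. D #> h j) \<in> {1..m} \<rightarrow> carrier (G Mod D)"
      using h q.hom_closed by blast
    show "(D #> h j) \<otimes>\<^bsub>G Mod D\<^esub> (D #> h j) = \<one>\<^bsub>G Mod D\<^esub>" if "j \<in> {1..m}" for j
      using h[OF that] q.hom_mult[of "h j" "h j"] q.hom_one by metis
  qed simp
  have f_singleton: "f {j} = D #> h j" if "j \<in> {1..m}" for j
    unfolding f_def using h[OF that] by (intro Q.finprod_of_singleton q.hom_closed) simp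
  fix a assume "a \<in> kernel G (Vgrp m) \<phi>"
  then have a: "a \<in> carrier G" "\<phi> a = {}"
    by (auto simp: kernel_def Vgrp_eq_F2_space)
  have "D #> a = (f \<circ> \<phi>) a"
  proof (rule hom_eq_on_generate[OF G Q.is_group q.homh])
    show "f \<circ> \<phi> \<in> hom G (G Mod D)"
      using hom f_hom by (rule Group.hom_compose)
    show "a \<in> generate G (h ` {1..m})"
      using a gen by simp
  qed (use h f_singleton in auto)
  then have "D #> a = D"
    using a by (simp add: f_def)
  then show "a \<in> derived G (carrier G)"
    using rcos_self[OF a(1) D.subgroup_axioms] by (simp add: D_def)
qed

subsection \<open>The universal group as a group of walks\<close>

lemma block_unique:
  assumes "x \<in> block k i" "x \<in> block k j"
  shows "i = j"
proof -
  have False if "i < j" "x \<in> block k i" "x \<in> block k j" for i j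
  proof -
    have "(\<Sum>l=1..i. k l) \<le> (\<Sum>l=1..<j. k l)"
      using that(1) by (intro sum_mono2) auto
    then show False
      using that(2,3) by (auto simp: block_def)
  qed
  then show ?thesis
    using assms by (meson linorder_neqE_nat)
qed

lemma block_nonempty:
  assumes "1 \<le> i" "1 \<le> k i"
  shows "block k i \<noteq> {}"
proof -
  have "{1..i} = insert i {1..<i}"
    using assms(1) by auto
  then show ?thesis
    using assms(2) by (simp add: block_def)
qed

lemma block_subset:
  assumes "i \<in> {1..n}"
  shows "block k i \<subseteq> {1..msum k n}"
proof -
  have "(\<Sum>l=1..i. k l) \<le> msum k n"
    unfolding msum_def using assms by (intro sum_mono2) auto
  then show ?thesis
    by (auto simp: block_def)
qed

lemma ex_block: "x \<in> {1..msum k n} \<Longrightarrow> \<exists>i\<in>{1..n}. x \<in> block k i"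
proof (induction n)
  case 0
  then show ?case by (simp add: msum_def)
next
  case (Suc n)
  show ?case
  proof (cases "x \<le> msum k n")
    case True
    then show ?thesis
      using Suc by fastforce
  next
    case False
    then have "x \<in> block k (Suc n)"
      using Suc.prems by (simp add: block_def msum_def atLeastLessThanSuc_atLeastAtMost)
    then show ?thesis by auto
  qed
qed

lemma blk_range: "x \<in> {1..msum k n} \<Longrightarrow> blk k n x \<in> {1..n}"
  and in_block_blk: "x \<in> {1..msum k n} \<Longrightarrow> x \<in> block k (blk k n x)"
proof -
  assume "x \<in> {1..msum k n}"
  then have "\<exists>!i. i \<in> {1..n} \<and> x \<in> block k i"
    using ex_block block_unique by metis
  from theI'[OF this] show "blk k n x \<in> {1..n}" "x \<in> block k (blk k n x)"
    by (auto simp: blk_def)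
qed

lemma in_block_iff_blk: "x \<in> {1..msum k n} \<Longrightarrow> x \<in> block k i \<longleftrightarrow> i = blk k n x"
  using in_block_blk block_unique by metis

lemma blk_image:
  assumes "\<forall>i\<in>{1..n}. 1 \<le> k i"
  shows "blk k n ` {1..msum k n} = {1..n}"
proof
  show "blk k n ` {1..msum k n} \<subseteq> {1..n}"
    using blk_range by blast
  show "{1..n} \<subseteq> blk k n ` {1..msum k n}"
  proof
    fix i assume i: "i \<in> {1..n}"
    then obtain x where "x \<in> block k i"
      using assms block_nonempty[of i k] by auto
    then show "i \<in> blk k n ` {1..msum k n}"
      using block_subset[OF i] in_block_iff_blk[of x k n i] by blast
  qed
qed

text \<open>This is \<open>\<pi>\<close> in the encoding of vectors as sets.\<close>

definition block_parity :: "(nat \<Rightarrow> nat) \<Rightarrow> nat \<Rightarrow> nat set \<Rightarrow> nat set" where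
  "block_parity k n A = {i \<in> {1..n}. odd (card (A \<inter> block k i))}"

lemma block_parity_empty [simp]: "block_parity k n {} = {}"
  by (simp add: block_parity_def)

lemma block_parity_singleton:
  assumes "j \<in> {1..msum k n}"
  shows "block_parity k n {j} = {blk k n j}"
proof -
  have "{j} \<inter> block k i = (if i = blk k n j then {j} else {})" for i
    using in_block_iff_blk[OF assms] by auto
  then show ?thesis
    using blk_range[OF assms] by (auto simp: block_parity_def)
qed

lemma block_parity_hom: "block_parity k n \<in> hom (Vgrp (msum k n)) (F2_space {1..n})"
proof (rule homI)
  fix A B assume "A \<in> carrier (Vgrp (msum k n))" "B \<in> carrier (Vgrp (msum k n))"
  then have "finite A" "finite B"
    by (auto simp: Vgrp_eq_F2_space intro: finite_subset)
  moreover have "symd A B \<inter> block k i = symd (A \<inter> block k i) (B \<inter> block k i)" for i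
    by auto
  ultimately show "block_parity k n (A \<otimes>\<^bsub>Vgrp (msum k n)\<^esub> B) =
      block_parity k n A \<otimes>\<^bsub>F2_space {1..n}\<^esub> block_parity k n B"
    by (auto simp: Vgrp_eq_F2_space block_parity_def odd_card_symd)
qed (auto simp: block_parity_def)

lemma ker_pi_eq: "ker_pi k n = {A. A \<subseteq> {1..msum k n} \<and> block_parity k n A = {}}"
  by (auto simp: ker_pi_def block_parity_def)

lemma in_translate [simp]: "e \<in> translate w a \<longleftrightarrow> symd e w \<in> a"
proof
  assume "symd e w \<in> a"
  then have "symd (symd e w) w \<in> translate w a"
    unfolding translate_def by blast
  then show "e \<in> translate w a"
    by simp
qed (auto simp: translate_def)

lemma card_translate: "card (translate w a) = card a"
  unfolding translate_def by (intro card_image inj_onI) (metis symd_cancel(2))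

lemma finite_translate: "finite a \<Longrightarrow> finite (translate w a)"
  by (simp add: translate_def)

lemma Gamma_simps:
  "carrier (Gamma n i) = Pow (Pow ({1..n} - {i})) \<times> Pow ({1..n} - {i})"
  "p \<otimes>\<^bsub>Gamma n i\<^esub> q = (symd (fst p) (translate (snd p) (fst q)), symd (snd p) (snd q))"
  "\<one>\<^bsub>Gamma n i\<^esub> = ({}, {})"
  by (simp_all add: Gamma_def case_prod_beta)

lemma group_Gamma: "group (Gamma n i)"
proof (rule groupI)
  have translate_subset: "translate w a \<subseteq> Pow S" if "w \<subseteq> S" "a \<subseteq> Pow S" for w a and S :: "nat set"
    using that by (auto simp: translate_def symd_def)
  fix p assume p: "p \<in> carrier (Gamma n i)"
  have "(translate (snd p) (fst p), snd p) \<in> carrier (Gamma n i)"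
    using p translate_subset[of "snd p" "{1..n} - {i}" "fst p"]
    by (simp add: Gamma_simps mem_Times_iff)
  moreover have "(translate (snd p) (fst p), snd p) \<otimes>\<^bsub>Gamma n i\<^esub> p = \<one>\<^bsub>Gamma n i\<^esub>"
    by (simp add: Gamma_simps)
  ultimately show "\<exists>q\<in>carrier (Gamma n i). q \<otimes>\<^bsub>Gamma n i\<^esub> p = \<one>\<^bsub>Gamma n i\<^esub>"
    by blast
  fix q assume q: "q \<in> carrier (Gamma n i)"
  have "translate (snd p) (fst q) \<subseteq> Pow ({1..n} - {i})"
    using p q by (intro translate_subset) (auto simp: Gamma_simps)
  then show "p \<otimes>\<^bsub>Gamma n i\<^esub> q \<in> carrier (Gamma n i)"
    using p q symd_subset[of "fst p" "Pow ({1..n} - {i})"] symd_subset[of "snd p" "{1..n} - {i}"]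
    by (auto simp only: Gamma_simps mem_Times_iff Pow_iff fst_conv snd_conv)
qed (auto simp: Gamma_simps symd_assoc set_eq_iff)

lemma group_Gprod: "group (Gprod k n)"
  unfolding Gprod_def using group_Gamma by simp

locale blocks =
  fixes k :: "nat \<Rightarrow> nat" and n :: nat
begin

abbreviation m :: nat where "m \<equiv> msum k n"
abbreviation b :: "nat \<Rightarrow> nat" where "b \<equiv> blk k n"
abbreviation g :: "nat \<Rightarrow> nat \<Rightarrow> nat set set \<times> nat set" where "g \<equiv> gt k n"
abbreviation \<Gamma> :: "(nat \<Rightarrow> nat set set \<times> nat set) monoid" where "\<Gamma> \<equiv> Gt k n"

lemma g_apply:
  assumes "j \<in> {1..m}" "x \<in> {1..m}"
  shows "g j x = (if b j = b x then (if j = x then {{}} else {}, {}) else ({}, {b j}))"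
  using assms in_block_iff_blk[OF assms(1)] by (auto simp: gt_def)

lemma carrier_Gprod: "carrier (Gprod k n) =
    (\<Pi>\<^sub>E x\<in>{1..m}. Pow (Pow ({1..n} - {b x})) \<times> Pow ({1..n} - {b x}))"
  by (simp add: Gprod_def Gamma_simps)

lemma g_in_Gprod:
  assumes "j \<in> {1..m}"
  shows "g j \<in> carrier (Gprod k n)"
proof -
  have "g j \<in> extensional {1..m}"
    by (simp add: gt_def)
  then show ?thesis
    unfolding carrier_Gprod using g_apply[OF assms] blk_range[OF assms] by (auto simp: PiE_iff)
qed

lemma group_Gt: "group \<Gamma>"
  unfolding Gt_def by (rule group.group_subgroup_generated[OF group_Gprod])

sublocale \<Gamma>: group \<Gamma>
  by (rule group_Gt)

lemma Gt_subset_Gprod: "carrier \<Gamma> \<subseteq> carrier (Gprod k n)"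
  unfolding Gt_def by (rule group.carrier_subgroup_generated_subset[OF group_Gprod])

lemma finite_Gt: "finite (carrier \<Gamma>)"
  using finite_subset[OF Gt_subset_Gprod] unfolding carrier_Gprod by (simp add: finite_PiE)

lemma Gt_mult: "x \<in> {1..m} \<Longrightarrow> (a \<otimes>\<^bsub>\<Gamma>\<^esub> c) x =
    (symd (fst (a x)) (translate (snd (a x)) (fst (c x))), symd (snd (a x)) (snd (c x)))"
  by (simp add: Gt_def Gprod_def Gamma_simps)

lemma Gt_one: "x \<in> {1..m} \<Longrightarrow> \<one>\<^bsub>\<Gamma>\<^esub> x = ({}, {})"
  by (simp add: Gt_def Gprod_def Gamma_simps)

lemma Gt_eqI:
  assumes "a \<in> carrier \<Gamma>" "c \<in> carrier \<Gamma>" "\<And>x. x \<in> {1..m} \<Longrightarrow> a x = c x"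
  shows "a = c"
  using assms Gt_subset_Gprod unfolding carrier_Gprod by (meson PiE_ext subsetD)

lemma fst_Gt_subset:
  assumes "a \<in> carrier \<Gamma>" "x \<in> {1..m}"
  shows "fst (a x) \<subseteq> Pow ({1..n} - {b x})"
  using assms Gt_subset_Gprod unfolding carrier_Gprod by (fastforce simp: PiE_iff mem_Times_iff)

lemma finite_fst_Gt: "a \<in> carrier \<Gamma> \<Longrightarrow> x \<in> {1..m} \<Longrightarrow> finite (fst (a x))"
  using fst_Gt_subset by (rule finite_subset) auto

lemma generate_Gt: "generate \<Gamma> (g ` {1..m}) = carrier \<Gamma>"
proof -
  interpret Gprod: group "Gprod k n"
    by (rule group_Gprod)
  have "carrier (Gprod k n) \<inter> g ` {1..m} = g ` {1..m}"
    using g_in_Gprod by auto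
  then have \<Gamma>: "\<Gamma> = Gprod k n\<lparr>carrier := generate (Gprod k n) (g ` {1..m})\<rparr>"
    by (simp add: Gt_def subgroup_generated_def)
  show ?thesis
    unfolding \<Gamma> using g_in_Gprod
    by (subst Gprod.generate_consistent) (auto intro: generate.incl Gprod.generate_is_subgroup)
qed

lemma g_in_Gt: "j \<in> {1..m} \<Longrightarrow> g j \<in> carrier \<Gamma>"
  using generate_Gt generate.incl[of "g j" "g ` {1..m}" \<Gamma>] by blast

lemma g_square: "j \<in> {1..m} \<Longrightarrow> g j \<otimes>\<^bsub>\<Gamma>\<^esub> g j = \<one>\<^bsub>\<Gamma>\<^esub>"
  by (rule Gt_eqI) (auto simp: g_in_Gt Gt_mult Gt_one g_apply)

lemma Gt_induct [consumes 1, case_names one mult]: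
  assumes "a \<in> carrier \<Gamma>" "P \<one>\<^bsub>\<Gamma>\<^esub>"
    and "\<And>a j. a \<in> carrier \<Gamma> \<Longrightarrow> j \<in> {1..m} \<Longrightarrow> P a \<Longrightarrow> P (a \<otimes>\<^bsub>\<Gamma>\<^esub> g j)"
  shows "P a"
proof -
  have "a \<in> generate \<Gamma> (g ` {1..m})"
    using assms(1) generate_Gt by simp
  then show ?thesis
  proof (induction rule: \<Gamma>.generate_involutions_induct)
    case (mult a s)
    then show ?case using assms(3) generate_Gt by auto
  qed (use assms(2) g_in_Gt g_square in auto)
qed

lemma phit_subset: "phit k n a \<subseteq> {1..m}"
  by (auto simp: phit_def)

lemma phit_hom: "phit k n \<in> hom \<Gamma> (Vgrp m)"
proof (rule homI)
  show "phit k n a \<in> carrier (Vgrp m)" for a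
    using phit_subset by (simp add: Vgrp_eq_F2_space)
  fix a c assume "a \<in> carrier \<Gamma>" "c \<in> carrier \<Gamma>"
  then have "augm (fst ((a \<otimes>\<^bsub>\<Gamma>\<^esub> c) x)) \<longleftrightarrow> augm (fst (a x)) \<noteq> augm (fst (c x))"
    if "x \<in> {1..m}" for x
    using that
    by (simp add: Gt_mult augm_def odd_card_symd card_translate finite_fst_Gt finite_translate)
  then show "phit k n (a \<otimes>\<^bsub>\<Gamma>\<^esub> c) = phit k n a \<otimes>\<^bsub>Vgrp m\<^esub> phit k n c"
    by (auto simp: phit_def Vgrp_eq_F2_space)
qed

lemma phit_g: "j \<in> {1..m} \<Longrightarrow> phit k n (g j) = {j}"
  by (auto simp: phit_def g_apply augm_def split: if_splits)

text \<open>The walk in the Cayley graph of \<open>F\<^sub>2\<^sup>n\<close> attached to an element of \<open>\<Gamma>\<close> ends in the vertex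
  \<open>endpt a\<close>. The edge of colour x joining w and \<open>w + e\<^sub>i\<close>, i = b x, is the pair (x, w)
  with i not in w, and \<open>chain a\<close> is the set of edges that are traversed an odd number of times.\<close>

abbreviation endpt :: "(nat \<Rightarrow> nat set set \<times> nat set) \<Rightarrow> nat set" where
  "endpt a \<equiv> block_parity k n (phit k n a)"

definition chain :: "(nat \<Rightarrow> nat set set \<times> nat set) \<Rightarrow> (nat \<times> nat set) set" where
  "chain a = (SIGMA x:{1..m}. fst (a x))"

definition edges :: "(nat \<times> nat set) set" where
  "edges = (SIGMA x:{1..m}. Pow ({1..n} - {b x}))"

lemma endpt_hom: "endpt \<in> hom \<Gamma> (F2_space {1..n})"
  using Group.hom_compose[OF phit_hom block_parity_hom] by (simp add: comp_def)

sublocale endpt: group_hom \<Gamma> "F2_space {1..n}" endpt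
  using endpt_hom by (simp add: group_hom_def group_hom_axioms_def group_F2_space)

lemma endpt_mult:
  "a \<in> carrier \<Gamma> \<Longrightarrow> c \<in> carrier \<Gamma> \<Longrightarrow> endpt (a \<otimes>\<^bsub>\<Gamma>\<^esub> c) = symd (endpt a) (endpt c)"
  using endpt.hom_mult by simp

lemma endpt_one: "endpt \<one>\<^bsub>\<Gamma>\<^esub> = {}"
  using endpt.hom_one by simp

lemma endpt_g: "j \<in> {1..m} \<Longrightarrow> endpt (g j) = {b j}"
  by (simp add: phit_g block_parity_singleton)

lemma endpt_mult_g:
  "a \<in> carrier \<Gamma> \<Longrightarrow> j \<in> {1..m} \<Longrightarrow> endpt (a \<otimes>\<^bsub>\<Gamma>\<^esub> g j) = symd (endpt a) {b j}"
  by (simp add: endpt_mult endpt_g g_in_Gt)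

lemma endpt_subset: "endpt a \<subseteq> {1..n}"
  by (auto simp: block_parity_def)

lemma snd_Gt: "a \<in> carrier \<Gamma> \<Longrightarrow> x \<in> {1..m} \<Longrightarrow> snd (a x) = endpt a - {b x}"
proof (induction rule: Gt_induct)
  case one
  then show ?case by (simp add: Gt_one endpt_one)
next
  case (mult a j)
  then have "snd ((a \<otimes>\<^bsub>\<Gamma>\<^esub> g j) x) = symd (endpt a - {b x}) (if b j = b x then {} else {b j})"
    by (simp add: Gt_mult g_apply)
  also have "\<dots> = symd (endpt a) {b j} - {b x}"
    by (auto split: if_splits)
  finally show ?case
    using mult by (simp add: endpt_mult_g)
qed

lemma in_chain_mult:
  assumes "a \<in> carrier \<Gamma>"
  shows "(x, w) \<in> chain (a \<otimes>\<^bsub>\<Gamma>\<^esub> c) \<longleftrightarrow>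
    ((x, w) \<in> chain a) \<noteq> ((x, symd w (endpt a - {b x})) \<in> chain c)"
  using assms
  by (cases "x \<in> {1..m}") (simp_all add: chain_def Gt_mult snd_Gt del: atLeastAtMost_iff)

lemma chain_one: "chain \<one>\<^bsub>\<Gamma>\<^esub> = {}"
  by (auto simp: chain_def Gt_one)

lemma chain_g: "j \<in> {1..m} \<Longrightarrow> chain (g j) = {(j, {})}"
  by (auto simp: chain_def g_apply split: if_splits)

lemma chain_mult_g:
  assumes "a \<in> carrier \<Gamma>" "j \<in> {1..m}"
  shows "chain (a \<otimes>\<^bsub>\<Gamma>\<^esub> g j) = symd (chain a) {(j, endpt a - {b j})}"
  unfolding set_eq_iff split_paired_All in_chain_mult[OF assms(1)] chain_g[OF assms(2)]
  by auto

lemma chain_mult_closed_walk: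
  assumes "a \<in> carrier \<Gamma>" "endpt a = {}"
  shows "chain (a \<otimes>\<^bsub>\<Gamma>\<^esub> c) = symd (chain a) (chain c)"
  unfolding set_eq_iff split_paired_All in_chain_mult[OF assms(1)] by (simp add: assms(2))

lemma finite_edges: "finite edges"
  by (simp add: edges_def)

lemma chain_subset_edges: "a \<in> carrier \<Gamma> \<Longrightarrow> chain a \<subseteq> edges"
  unfolding chain_def edges_def using fst_Gt_subset by (intro Sigma_mono) auto

lemma chain_endpt_inject:
  assumes "a \<in> carrier \<Gamma>" "c \<in> carrier \<Gamma>" "chain a = chain c" "endpt a = endpt c"
  shows "a = c"
proof (rule Gt_eqI[OF assms(1,2)])
  fix x assume x: "x \<in> {1..m}"
  have "fst (a x) = chain a `` {x}" "fst (c x) = chain c `` {x}"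
    using x by (auto simp: chain_def)
  moreover have "snd (a x) = snd (c x)"
    using assms x by (simp add: snd_Gt)
  ultimately show "a x = c x"
    using assms(3) by (simp add: prod_eq_iff)
qed

definition closed_walks :: "(nat \<Rightarrow> nat set set \<times> nat set) set" where
  "closed_walks = kernel \<Gamma> (F2_space {1..n}) endpt"

lemma closed_walks_iff: "a \<in> closed_walks \<longleftrightarrow> a \<in> carrier \<Gamma> \<and> endpt a = {}"
  by (simp add: closed_walks_def kernel_def)

lemma elem_ab2_closed_walks: "elem_ab2 \<Gamma> closed_walks"
proof -
  have "a \<otimes>\<^bsub>\<Gamma>\<^esub> c = c \<otimes>\<^bsub>\<Gamma>\<^esub> a" if "a \<in> closed_walks" "c \<in> closed_walks" for a c
    using that by (intro chain_endpt_inject)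
      (simp_all add: closed_walks_iff chain_mult_closed_walk endpt_mult symd_commute)
  moreover have "a \<otimes>\<^bsub>\<Gamma>\<^esub> a = \<one>\<^bsub>\<Gamma>\<^esub>" if "a \<in> closed_walks" for a
    using that by (intro chain_endpt_inject)
      (simp_all add: closed_walks_iff chain_mult_closed_walk endpt_mult chain_one endpt_one)
  ultimately show ?thesis
    using endpt.subgroup_kernel by (simp add: elem_ab2_def closed_walks_def)
qed

lemma block_expansion_group_Gt: "block_expansion_group k n \<Gamma> (phit k n) g"
proof -
  interpret phit: group_hom \<Gamma> "Vgrp m" "phit k n"
    using phit_hom group_F2_space
    by (simp add: group_hom_def group_hom_axioms_def Vgrp_eq_F2_space)
  let ?N = "kernel \<Gamma> (Vgrp m) (phit k n)"
  have "?N \<subseteq> closed_walks"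
    by (auto simp: closed_walks_iff kernel_def Vgrp_eq_F2_space)
  then have "elem_ab2 \<Gamma> ?N"
    using elem_ab2_closed_walks phit.subgroup_kernel elem_ab2_subset by blast
  moreover have "derived \<Gamma> (carrier \<Gamma>) = ?N"
    using phit.derived_subset_kernel kernel_subset_derived[OF group_Gt phit_hom _ generate_Gt]
    by (simp add: Vgrp_eq_F2_space comm_group_F2_space g_in_Gt phit_g g_square subset_antisym)
  moreover have "{a \<in> carrier \<Gamma>. phit k n a \<in> ker_pi k n} = closed_walks"
    unfolding set_eq_iff mem_Collect_eq ker_pi_eq closed_walks_iff using phit_subset by blast
  ultimately show ?thesis
    unfolding block_expansion_group_def expansion_group_def
    using phit_hom elem_ab2_closed_walks by (simp add: g_in_Gt phit_g g_square)
qed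

end

subsection \<open>Values of walks\<close>

locale block_expansion = blocks k n for k n +
  fixes G (structure) and \<phi> :: "'g \<Rightarrow> nat set" and h :: "nat \<Rightarrow> 'g"
  assumes block_expansion_group: "block_expansion_group k n G \<phi> h"
begin

abbreviation vertex :: "'g \<Rightarrow> nat set" where
  "vertex a \<equiv> block_parity k n (\<phi> a)"

definition loops :: "'g set" where
  "loops = kernel G (F2_space {1..n}) vertex"

abbreviation loop_group :: "('g, 'a) monoid_scheme" where
  "loop_group \<equiv> G\<lparr>carrier := loops\<rparr>"

lemma expansion_group: "expansion_group m G \<phi> h"
  using block_expansion_group by (simp add: block_expansion_group_def)

lemma \<phi>_hom: "\<phi> \<in> hom G (Vgrp m)"
  using expansion_group by (simp add: expansion_group_def)

lemma \<phi>_subset: "a \<in> carrier G \<Longrightarrow> \<phi> a \<subseteq> {1..m}"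
  using hom_in_carrier[OF \<phi>_hom] by (simp add: Vgrp_eq_F2_space)

sublocale group G
  using expansion_group by (simp add: expansion_group_def)

sublocale vertex: group_hom G "F2_space {1..n}" vertex
  using Group.hom_compose[OF \<phi>_hom block_parity_hom]
  by (simp add: group_hom_def group_hom_axioms_def group_F2_space comp_def)

lemma h_closed [simp]: "j \<in> {1..m} \<Longrightarrow> h j \<in> carrier G"
  using expansion_group by (simp add: expansion_group_def)

lemma inv_h: "j \<in> {1..m} \<Longrightarrow> inv (h j) = h j"
  using expansion_group by (intro inv_equality) (auto simp: expansion_group_def)

lemma vertex_h: "j \<in> {1..m} \<Longrightarrow> vertex (h j) = {b j}"
  using expansion_group by (simp add: expansion_group_def block_parity_singleton)

lemma loops_iff: "a \<in> loops \<longleftrightarrow> a \<in> carrier G \<and> vertex a = {}"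
  by (simp add: loops_def kernel_def)

lemma elem_ab2_loops: "elem_ab2 G loops"
proof -
  have "{a \<in> carrier G. \<phi> a \<in> ker_pi k n} = loops"
    unfolding set_eq_iff mem_Collect_eq ker_pi_eq loops_iff using \<phi>_subset by blast
  then show ?thesis
    using block_expansion_group by (simp add: block_expansion_group_def)
qed

sublocale loop_group: comm_group loop_group
proof (rule group.group_comm_groupI)
  show "group loop_group"
    using elem_ab2_loops by (simp add: elem_ab2_def subgroup_imp_group)
qed (use elem_ab2_loops in \<open>simp add: elem_ab2_def\<close>)

lemma loops_square: "a \<in> loops \<Longrightarrow> a \<otimes> a = \<one>"
  using elem_ab2_loops by (simp add: elem_ab2_def)

lemma inv_loop: "a \<in> loops \<Longrightarrow> inv a = a"
  using loops_square by (intro inv_equality) (auto simp: loops_iff)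

lemma vertex_surj:
  assumes "\<forall>i\<in>{1..n}. 1 \<le> k i"
  shows "vertex ` carrier G = Pow {1..n}"
proof -
  have "(\<lambda>i. {i}) ` {1..n} = (\<lambda>j. vertex (h j)) ` {1..m}"
    unfolding blk_image[OF assms, symmetric] using vertex_h by (auto simp: image_image)
  then have "(\<lambda>i. {i}) ` {1..n} \<subseteq> vertex ` carrier G"
    by auto
  then show ?thesis
    using generate_F2_space[of "{1..n}"] vertex.surj_if_generators_in_image by simp
qed

end

text \<open>The element \<open>lift u\<close> is the value of a chosen path from 0 to the vertex u, and \<open>edge_loop e\<close>
  is the value of the loop that runs through the edge e along the chosen paths.\<close>

locale lifted_block_expansion = block_expansion k n G \<phi> h for k n and G (structure) and \<phi> h +
  fixes lift :: "nat set \<Rightarrow> 'a"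
  assumes lift_empty [simp]: "lift {} = \<one>"
    and lift_closed [simp]: "u \<subseteq> {1..n} \<Longrightarrow> lift u \<in> carrier G"
    and vertex_lift: "u \<subseteq> {1..n} \<Longrightarrow> vertex (lift u) = u"

lemma (in block_expansion) exists_lift:
  assumes "\<forall>i\<in>{1..n}. 1 \<le> k i"
  obtains lift where "lifted_block_expansion k n G \<phi> h lift"
proof -
  have "\<exists>a\<in>carrier G. vertex a = u" if "u \<subseteq> {1..n}" for u
    using vertex_surj[OF assms] that by (metis PowI imageE)
  then obtain p where "\<And>u. u \<subseteq> {1..n} \<Longrightarrow> p u \<in> carrier G \<and> vertex (p u) = u"
    by metis
  then have "lifted_block_expansion k n G \<phi> h (p({} := \<one>))"
    using vertex.hom_one by unfold_locales auto
  then show thesis ..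
qed

context lifted_block_expansion
begin

definition edge_loop :: "nat \<times> nat set \<Rightarrow> 'a" where
  "edge_loop = (\<lambda>(x, w). lift w \<otimes> h x \<otimes> inv (lift (insert (b x) w)))"

lemma edge_loop_in_loops:
  assumes "e \<in> edges"
  shows "edge_loop e \<in> loops"
proof -
  obtain x w where e: "e = (x, w)" "x \<in> {1..m}" "w \<subseteq> {1..n}" "b x \<notin> w"
    using assms unfolding edges_def by blast
  then have w': "insert (b x) w \<subseteq> {1..n}" "insert (b x) w = symd w {b x}"
    using blk_range by auto
  have "vertex (edge_loop e) = symd (symd w {b x}) (insert (b x) w)"
    using e w'(1) by (simp add: edge_loop_def vertex_lift vertex_h inv_F2_space)
  then show ?thesis
    using e w' by (simp add: loops_iff edge_loop_def)
qed

lemma edge_loop_eq: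
  assumes "x \<in> {1..m}" "w \<subseteq> {1..n}"
  shows "edge_loop (x, w - {b x}) = lift w \<otimes> h x \<otimes> inv (lift (symd w {b x}))"
proof (cases "b x \<in> w")
  case True
  then have "(x, w - {b x}) \<in> edges"
    and w: "insert (b x) (w - {b x}) = w" "symd w {b x} = w - {b x}"
    using assms by (auto simp: edges_def)
  then have "edge_loop (x, w - {b x}) = inv (edge_loop (x, w - {b x}))"
    using edge_loop_in_loops inv_loop by simp
  moreover have "lift (w - {b x}) \<in> carrier G"
    using assms by (intro lift_closed) auto
  ultimately show ?thesis
    using assms w by (simp add: edge_loop_def inv_mult_group inv_h m_assoc)
next
  case False
  then have "w - {b x} = w" "symd w {b x} = insert (b x) w"
    by auto
  then show ?thesis
    by (simp add: edge_loop_def)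
qed

lemma edge_loop_mult_lift:
  assumes "x \<in> {1..m}" "w \<subseteq> {1..n}"
  shows "edge_loop (x, w - {b x}) \<otimes> lift (symd w {b x}) = lift w \<otimes> h x"
proof -
  have "symd w {b x} \<subseteq> {1..n}"
    using assms blk_range by (intro symd_subset) auto
  then show ?thesis
    using assms by (simp add: edge_loop_eq m_assoc)
qed

definition edge_product :: "(nat \<times> nat set) set \<Rightarrow> 'a" where
  "edge_product = finprod loop_group edge_loop"

lemma edge_product_hom: "edge_product \<in> hom (F2_space edges) loop_group"
  unfolding edge_product_def
  using edge_loop_in_loops loops_square finite_edges
  by (intro loop_group.finprod_hom_F2_space) auto

lemma edge_product_in_loops: "c \<subseteq> edges \<Longrightarrow> edge_product c \<in> loops"
  using hom_in_carrier[OF edge_product_hom] by simp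

lemma edge_product_singleton: "e \<in> edges \<Longrightarrow> edge_product {e} = edge_loop e"
  unfolding edge_product_def using edge_loop_in_loops
  by (intro loop_group.finprod_of_singleton) simp

lemma edge_product_symd:
  "c \<subseteq> edges \<Longrightarrow> c' \<subseteq> edges \<Longrightarrow> edge_product (symd c c') = edge_product c \<otimes> edge_product c'"
  using hom_mult[OF edge_product_hom] by simp

lemma edge_product_empty: "edge_product {} = \<one>"
  by (simp add: edge_product_def)

definition walk_value :: "(nat \<Rightarrow> nat set set \<times> nat set) \<Rightarrow> 'a" where
  "walk_value a = edge_product (chain a) \<otimes> lift (endpt a)"

lemma walk_value_closed: "a \<in> carrier \<Gamma> \<Longrightarrow> walk_value a \<in> carrier G"
  using edge_product_in_loops[OF chain_subset_edges] endpt_subset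
  by (simp add: walk_value_def loops_iff)

lemma walk_value_one: "walk_value \<one>\<^bsub>\<Gamma>\<^esub> = \<one>"
  by (simp add: walk_value_def chain_one endpt_one edge_product_empty)

lemma walk_value_mult_g:
  assumes a: "a \<in> carrier \<Gamma>" and j: "j \<in> {1..m}"
  shows "walk_value (a \<otimes>\<^bsub>\<Gamma>\<^esub> g j) = walk_value a \<otimes> h j"
proof -
  let ?e = "(j, endpt a - {b j})"
  have e: "?e \<in> edges"
    using j endpt_subset[of a] by (auto simp: edges_def)
  have "edge_product (chain (a \<otimes>\<^bsub>\<Gamma>\<^esub> g j)) = edge_product (chain a) \<otimes> edge_loop ?e"
    using a j e chain_subset_edges
    by (simp add: chain_mult_g edge_product_symd edge_product_singleton)
  then have "walk_value (a \<otimes>\<^bsub>\<Gamma>\<^esub> g j)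
      = edge_product (chain a) \<otimes> edge_loop ?e \<otimes> lift (symd (endpt a) {b j})"
    using a j by (simp add: walk_value_def endpt_mult_g)
  also have "\<dots> = edge_product (chain a) \<otimes> (edge_loop ?e \<otimes> lift (symd (endpt a) {b j}))"
    using edge_product_in_loops[OF chain_subset_edges[OF a]] edge_loop_in_loops[OF e]
      lift_closed[OF endpt_subset[of "a \<otimes>\<^bsub>\<Gamma>\<^esub> g j"]]
    by (intro m_assoc) (simp_all add: loops_iff endpt_mult_g[OF a j])
  also have "\<dots> = edge_product (chain a) \<otimes> (lift (endpt a) \<otimes> h j)"
    using edge_loop_mult_lift[OF j endpt_subset] by simp
  also have "\<dots> = walk_value a \<otimes> h j"
    unfolding walk_value_def using edge_product_in_loops[OF chain_subset_edges[OF a]] j endpt_subset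
    by (intro m_assoc[symmetric]) (auto simp: loops_iff)
  finally show ?thesis .
qed

lemma expansion_hom_walk_value: "expansion_hom m \<Gamma> g G h walk_value"
proof -
  have "walk_value (a \<otimes>\<^bsub>\<Gamma>\<^esub> c) = walk_value a \<otimes> walk_value c"
    if "c \<in> carrier \<Gamma>" "a \<in> carrier \<Gamma>" for a c
    using that
  proof (induction rule: Gt_induct)
    case one
    then show ?case using walk_value_closed walk_value_one by simp
  next
    case (mult c j)
    have "walk_value (a \<otimes>\<^bsub>\<Gamma>\<^esub> (c \<otimes>\<^bsub>\<Gamma>\<^esub> g j)) = walk_value (a \<otimes>\<^bsub>\<Gamma>\<^esub> c) \<otimes> h j"
      using mult walk_value_mult_g[of "a \<otimes>\<^bsub>\<Gamma>\<^esub> c" j] by (simp add: \<Gamma>.m_assoc g_in_Gt)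
    then show ?case
      using mult walk_value_closed walk_value_mult_g by (simp add: m_assoc)
  qed
  moreover have "walk_value (g j) = h j" if "j \<in> {1..m}" for j
    using walk_value_mult_g[OF \<Gamma>.one_closed that] that by (simp add: walk_value_one g_in_Gt)
  ultimately show ?thesis
    using walk_value_closed by (auto simp: expansion_hom_def intro: homI)
qed

end

lemma (in blocks) expansion_hom_unique:
  assumes "group G" "expansion_hom m \<Gamma> g G h f" "expansion_hom m \<Gamma> g G h f'" "a \<in> carrier \<Gamma>"
  shows "f' a = f a"
proof (rule hom_eq_on_generate[OF group_Gt assms(1)])
  show "a \<in> generate \<Gamma> (g ` {1..m})"
    using assms(4) generate_Gt by simp
qed (use assms g_in_Gt in \<open>auto simp: expansion_hom_def\<close>)

context block_expansion
begin

lemma exists_expansion_hom: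
  assumes "\<forall>i\<in>{1..n}. 1 \<le> k i"
  obtains f where "expansion_hom m \<Gamma> g G h f"
proof -
  obtain lift where "lifted_block_expansion k n G \<phi> h lift"
    using exists_lift[OF assms] .
  then show thesis
    by (intro that) (rule lifted_block_expansion.expansion_hom_walk_value)
qed

lemma expansion_hom_surj:
  assumes "expansion_hom m \<Gamma> g G h f"
  shows "f ` carrier \<Gamma> = carrier G"
proof -
  interpret f: group_hom \<Gamma> G f
    using assms by (simp add: group_hom_def group_hom_axioms_def expansion_hom_def)
  have "h ` {1..m} \<subseteq> f ` carrier \<Gamma>"
    using assms g_in_Gt by (force simp: expansion_hom_def image_iff)
  then show ?thesis
    by (rule f.surj_if_generators_in_image[OF _ expansion_group_generated[OF expansion_group]])
qed

lemma
  assumes "expansion_hom m \<Gamma> g G h f"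
  shows finite_carrier: "finite (carrier G)"
    and card_carrier_le: "card (carrier G) \<le> order \<Gamma>"
    and card_carrier_eq_iff_iso: "card (carrier G) = order \<Gamma> \<longleftrightarrow> f \<in> iso \<Gamma> G"
proof -
  note surj = expansion_hom_surj[OF assms]
  show "finite (carrier G)"
    using finite_imageI[OF finite_Gt, of f] by (simp add: surj)
  show "card (carrier G) \<le> order \<Gamma>"
    using card_image_le[OF finite_Gt, of f] by (simp add: order_def surj)
  show "card (carrier G) = order \<Gamma> \<longleftrightarrow> f \<in> iso \<Gamma> G"
    using assms surj finite_Gt inj_on_iff_eq_card[of "carrier \<Gamma>" f]
    by (auto simp: order_def iso_def bij_betw_def expansion_hom_def)
qed

end

subsection \<open>The order of the universal group\<close>

context blocks
begin

lemma card_edges: "card edges = m * 2 ^ (n - 1)"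
proof -
  have "card edges = (\<Sum>x\<in>{1..m}. card (Pow ({1..n} - {b x})))"
    unfolding edges_def by (rule card_SigmaI) auto
  also have "\<dots> = (\<Sum>x\<in>{1..m}. 2 ^ (n - 1))"
    using blk_range by (intro sum.cong) (simp_all add: card_Pow)
  finally show ?thesis by simp
qed

text \<open>The boundary is taken relative to the vertex 0, so that a chain is the chain of a closed walk
  from 0 exactly if its boundary vanishes, and every set of nonzero vertices is a boundary.\<close>

definition nonzero_vertices :: "nat set set" where
  "nonzero_vertices = Pow {1..n} - {{}}"

definition edge_ends :: "nat \<times> nat set \<Rightarrow> nat set set" where
  "edge_ends = (\<lambda>(x, w). {w, insert (b x) w} - {{}})"

definition boundary :: "(nat \<times> nat set) set \<Rightarrow> nat set set" where
  "boundary = finprod (F2_space nonzero_vertices) edge_ends"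

definition cycles :: "(nat \<times> nat set) set set" where
  "cycles = kernel (F2_space edges) (F2_space nonzero_vertices) boundary"

lemma finite_nonzero_vertices: "finite nonzero_vertices"
  by (simp add: nonzero_vertices_def)

lemma card_nonzero_vertices: "card nonzero_vertices = 2 ^ n - 1"
  by (simp add: nonzero_vertices_def card_Diff_singleton card_Pow)

lemma edge_ends_subset:
  assumes "e \<in> edges"
  shows "edge_ends e \<subseteq> nonzero_vertices"
proof -
  obtain x w where e: "e = (x, w)" "x \<in> {1..m}" "w \<subseteq> {1..n}"
    using assms unfolding edges_def by blast
  then have "insert (b x) w \<subseteq> {1..n}"
    using blk_range by auto
  with e show ?thesis
    by (auto simp: edge_ends_def nonzero_vertices_def)
qed

lemma edge_ends_eq_symd: "edge_ends (x, u - {b x}) = symd ({u} - {{}}) ({symd u {b x}} - {{}})"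
proof -
  have "{u - {b x}, insert (b x) (u - {b x})} = {u, symd u {b x}}"
  proof (cases "b x \<in> u")
    case True
    then have "symd u {b x} = u - {b x}"
      by auto
    with True show ?thesis
      by (simp add: insert_absorb insert_commute)
  next
    case False
    then have "symd u {b x} = insert (b x) u"
      by auto
    with False show ?thesis
      by simp
  qed
  then have "edge_ends (x, u - {b x}) = {u, symd u {b x}} - {{}}"
    by (simp add: edge_ends_def)
  moreover have "symd u {b x} \<noteq> u"
    by (metis insert_not_empty symd_cancel(1) symd_self)
  ultimately show ?thesis
    by (simp add: symd_singletons)
qed

lemma boundary_hom: "boundary \<in> hom (F2_space edges) (F2_space nonzero_vertices)"
  unfolding boundary_def using edge_ends_subset finite_edges
  by (intro comm_group.finprod_hom_F2_space comm_group_F2_space) auto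

sublocale boundary: group_hom "F2_space edges" "F2_space nonzero_vertices" boundary
  using boundary_hom by (simp add: group_hom_def group_hom_axioms_def group_F2_space)

lemma boundary_singleton: "e \<in> edges \<Longrightarrow> boundary {e} = edge_ends e"
  unfolding boundary_def using edge_ends_subset
  by (intro comm_monoid.finprod_of_singleton comm_group.axioms comm_group_F2_space) simp

lemma boundary_chain: "a \<in> carrier \<Gamma> \<Longrightarrow> boundary (chain a) = {endpt a} - {{}}"
proof (induction rule: Gt_induct)
  case one
  then show ?case using boundary.hom_one by (simp add: chain_one endpt_one)
next
  case (mult a j)
  let ?u = "endpt a" and ?e = "(j, endpt a - {b j})"
  have e: "?e \<in> edges"
    using mult endpt_subset[of a] by (auto simp: edges_def)
  have "boundary (chain (a \<otimes>\<^bsub>\<Gamma>\<^esub> g j)) = symd (boundary (chain a)) (boundary {?e})"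
    using mult e boundary.hom_mult[of "chain a" "{?e}"] chain_subset_edges
    by (simp add: chain_mult_g)
  then show ?case
    using mult e by (simp add: boundary_singleton edge_ends_eq_symd endpt_mult_g)
qed

lemma chain_hom: "chain \<in> hom (\<Gamma>\<lparr>carrier := closed_walks\<rparr>) (F2_space edges)"
  using chain_subset_edges chain_mult_closed_walk by (intro homI) (auto simp: closed_walks_iff)

end

locale lifted_walks = lifted_block_expansion k n "Gt k n" "phit k n" "gt k n" lift for k n lift
begin

definition path_sum :: "nat set set \<Rightarrow> (nat \<times> nat set) set" where
  "path_sum = finprod (F2_space edges) (\<lambda>u. chain (lift u))"

lemma chain_lift_subset: "u \<subseteq> {1..n} \<Longrightarrow> chain (lift u) \<subseteq> edges"
  by (intro chain_subset_edges lift_closed)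

lemma path_sum_hom: "path_sum \<in> hom (F2_space nonzero_vertices) (F2_space edges)"
  unfolding path_sum_def
  by (intro comm_group.finprod_hom_F2_space comm_group_F2_space finite_nonzero_vertices Pi_I)
    (simp_all add: nonzero_vertices_def chain_lift_subset)

sublocale path_sum: group_hom "F2_space nonzero_vertices" "F2_space edges" path_sum
  using path_sum_hom by (simp add: group_hom_def group_hom_axioms_def group_F2_space)

lemma path_sum_vertex:
  assumes "u \<subseteq> {1..n}"
  shows "path_sum ({u} - {{}}) = chain (lift u)"
proof (cases "u = {}")
  case True
  then show ?thesis using path_sum.hom_one by (simp add: chain_one)
next
  case False
  then have "path_sum {u} = chain (lift u)"
    unfolding path_sum_def using chain_lift_subset[OF assms]
    by (intro comm_monoid.finprod_of_singleton comm_group.axioms comm_group_F2_space) simp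
  with False show ?thesis by simp
qed

lemma chain_edge_loop:
  assumes "e \<in> edges"
  shows "chain (edge_loop e) = symd {e} (path_sum (edge_ends e))"
proof -
  obtain x w where e: "e = (x, w)" "x \<in> {1..m}" "w \<subseteq> {1..n}" "b x \<notin> w"
    using assms unfolding edges_def by blast
  let ?w = "insert (b x) w"
  have w: "?w \<subseteq> {1..n}" "symd w {b x} = ?w" "w - {b x} = w"
    using e blk_range by auto
  have loop: "edge_loop e \<in> carrier \<Gamma>" "endpt (edge_loop e) = {}"
    using edge_loop_in_loops[OF assms] by (simp_all add: loops_iff)
  have "edge_loop e \<otimes>\<^bsub>\<Gamma>\<^esub> lift ?w = lift w \<otimes>\<^bsub>\<Gamma>\<^esub> g x"
    using edge_loop_mult_lift[OF e(2,3)] w e(1) by simp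
  then have "symd (chain (edge_loop e)) (chain (lift ?w)) = symd (chain (lift w)) {e}"
    using chain_mult_closed_walk[OF loop, of "lift ?w"] chain_mult_g[OF lift_closed[OF e(3)] e(2)]
      vertex_lift[OF e(3)] w e(1) by simp
  then have "chain (edge_loop e) = symd {e} (symd (chain (lift w)) (chain (lift ?w)))"
    by (metis symd_assoc symd_cancel(2) symd_commute)
  also have "symd (chain (lift w)) (chain (lift ?w)) = path_sum (symd ({w} - {{}}) ({?w} - {{}}))"
    using path_sum.hom_mult[of "{w} - {{}}" "{?w} - {{}}"] e(3) w(1)
    by (simp only: path_sum_vertex F2_space_simps) (auto simp: nonzero_vertices_def)
  also have "symd ({w} - {{}}) ({?w} - {{}}) = edge_ends e"
    using edge_ends_eq_symd[of x w] e(1) w by simp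
  finally show ?thesis .
qed

lemma chain_edge_product:
  assumes "c \<subseteq> edges"
  shows "chain (edge_product c) = symd c (path_sum (boundary c))"
proof (rule hom_F2_space_eqI[OF finite_edges group_F2_space _ _ _ assms])
  have "loops = closed_walks"
    by (simp add: loops_def closed_walks_def)
  then show "(\<lambda>c. chain (edge_product c)) \<in> hom (F2_space edges) (F2_space edges)"
    using Group.hom_compose[OF edge_product_hom] chain_hom by (simp add: comp_def)
  show "(\<lambda>c. symd c (path_sum (boundary c))) \<in> hom (F2_space edges) (F2_space edges)"
    using comm_group.hom_group_mult[OF comm_group_F2_space, of "\<lambda>c. c" "F2_space edges" edges
        "\<lambda>c. path_sum (boundary c)"] Group.hom_compose[OF boundary_hom path_sum_hom]
    by (simp add: comp_def hom_def)
  show "chain (edge_product {e}) = symd {e} (path_sum (boundary {e}))" if "e \<in> edges" for e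
    using that by (simp add: edge_product_singleton boundary_singleton chain_edge_loop)
qed

lemma boundary_surj: "boundary ` Pow edges = Pow nonzero_vertices"
proof -
  have "{u} \<in> boundary ` Pow edges" if "u \<in> nonzero_vertices" for u
  proof -
    have u: "u \<subseteq> {1..n}" "u \<noteq> {}"
      using that by (auto simp: nonzero_vertices_def)
    then have "{u} = boundary (chain (lift u))"
      using boundary_chain[OF lift_closed[OF u(1)]] vertex_lift[OF u(1)] by simp
    then show ?thesis
      using chain_lift_subset[OF u(1)] by blast
  qed
  then show ?thesis
    using boundary.surj_if_generators_in_image[of "(\<lambda>u. {u}) ` nonzero_vertices"]
      generate_F2_space[OF finite_nonzero_vertices] by auto
qed

lemma bij_betw_chain_cycles: "bij_betw chain closed_walks cycles"
proof (rule bij_betw_imageI)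
  show "inj_on chain closed_walks"
    using chain_endpt_inject by (auto simp: inj_on_def closed_walks_iff)
  show "chain ` closed_walks = cycles"
  proof
    show "chain ` closed_walks \<subseteq> cycles"
      by (intro image_subsetI)
        (simp add: closed_walks_iff cycles_def kernel_def boundary_chain chain_subset_edges)
    show "cycles \<subseteq> chain ` closed_walks"
    proof
      fix c assume "c \<in> cycles"
      then have c: "c \<subseteq> edges" "boundary c = {}"
        by (auto simp: cycles_def kernel_def)
      then have "chain (edge_product c) = c"
        using path_sum.hom_one by (simp add: chain_edge_product)
      moreover have "edge_product c \<in> closed_walks"
        using edge_product_in_loops[OF c(1)] by (simp add: loops_def closed_walks_def)
      ultimately show "c \<in> chain ` closed_walks"
        by force
    qed
  qed
qed

end

lemma (in blocks) order_Gt: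
  assumes "\<forall>i\<in>{1..n}. 1 \<le> k i"
  shows "order \<Gamma> = 2 ^ (m * 2 ^ (n - 1) + n + 1 - 2 ^ n)"
proof -
  interpret G: block_expansion k n \<Gamma> "phit k n" g
    using block_expansion_group_Gt by unfold_locales
  obtain lift where "lifted_block_expansion k n \<Gamma> (phit k n) g lift"
    using G.exists_lift[OF assms] .
  then interpret lifted_walks k n lift
    by (rule lifted_walks.intro)
  have "order (F2_space edges) = card cycles * order (F2_space nonzero_vertices)"
    unfolding cycles_def using boundary_surj
    by (intro boundary.order_eq_card_kernel_times_order) simp
  then have card_cycles: "2 ^ (m * 2 ^ (n - 1)) = card cycles * 2 ^ (2 ^ n - 1)"
    by (simp add: order_F2_space finite_edges finite_nonzero_vertices card_edges
        card_nonzero_vertices)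
  have "order \<Gamma> = card closed_walks * order (F2_space {1..n})"
    unfolding closed_walks_def using G.vertex_surj[OF assms]
    by (intro endpt.order_eq_card_kernel_times_order) simp
  then have order_eq: "order \<Gamma> = card cycles * 2 ^ n"
    using bij_betw_same_card[OF bij_betw_chain_cycles] by (simp add: order_F2_space)
  have "(2::nat) ^ (2 ^ n - 1) \<le> 2 ^ (m * 2 ^ (n - 1))"
    using card_cycles by (cases "card cycles") auto
  then have "(2::nat) ^ n - 1 \<le> m * 2 ^ (n - 1)"
    by (rule power_le_imp_le_exp[rotated]) simp
  then have exponent: "m * 2 ^ (n - 1) + n = (m * 2 ^ (n - 1) + n + 1 - 2 ^ n) + (2 ^ n - 1)"
    using one_le_power[of "2::nat" n] by linarith
  have "order \<Gamma> * 2 ^ (2 ^ n - 1) = 2 ^ (m * 2 ^ (n - 1) + n)"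
    using card_cycles by (simp add: order_eq power_add)
  also have "\<dots> = 2 ^ (m * 2 ^ (n - 1) + n + 1 - 2 ^ n) * 2 ^ (2 ^ n - 1)"
    by (simp only: power_add[symmetric] exponent[symmetric])
  finally show ?thesis
    by simp
qed

theorem theorem3p20:
  fixes n :: nat and k :: "nat \<Rightarrow> nat"
    and G :: "('g, 'c) monoid_scheme" and \<phi> :: "'g \<Rightarrow> nat set" and h :: "nat \<Rightarrow> 'g"
  assumes "\<forall>i\<in>{1..n}. 1 \<le> k i"
  shows "block_expansion_group k n (Gt k n) (phit k n) (gt k n) \<and>
    (block_expansion_group k n G \<phi> h \<longrightarrow>
      (\<exists>f. expansion_hom (msum k n) (Gt k n) (gt k n) G h f
           \<and> f ` carrier (Gt k n) = carrier G
           \<and> (\<forall>f'. expansion_hom (msum k n) (Gt k n) (gt k n) G h f'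
                    \<and> f' ` carrier (Gt k n) = carrier G
                   \<longrightarrow> (\<forall>x\<in>carrier (Gt k n). f' x = f x))
           \<and> finite (carrier G)
           \<and> card (carrier G) \<le> 2 ^ (msum k n * 2 ^ (n - 1) + n + 1 - 2 ^ n)
           \<and> (card (carrier G) = 2 ^ (msum k n * 2 ^ (n - 1) + n + 1 - 2 ^ n)
                \<longleftrightarrow> f \<in> iso (Gt k n) G)))"
proof (cases "block_expansion_group k n G \<phi> h")
  case True
  then interpret block_expansion k n G \<phi> h
    by unfold_locales
  obtain f where f: "expansion_hom m \<Gamma> g G h f"
    using exists_expansion_hom[OF assms] .
  have unique: "\<forall>a\<in>carrier \<Gamma>. f' a = f a" if "expansion_hom m \<Gamma> g G h f'" for f'
    using expansion_hom_unique[OF is_group f that] by blast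
  show ?thesis
    using block_expansion_group_Gt f unique expansion_hom_surj[OF f] finite_carrier[OF f]
      card_carrier_le[OF f] card_carrier_eq_iff_iso[OF f] unfolding order_Gt[OF assms] by blast
next
  case False
  then show ?thesis
    using blocks.block_expansion_group_Gt by blast
qed

end
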